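(* The map $\varphi_3:\mathcal T_3\to\mathbb R^{I_3}$ defined in the context takes values in $\mathbb R_{>0}^{I_3}$ and is a bijection $\mathcal T_3\to\mathbb R_{>0}^{I_3}$.
   Context: A flag in $\mathbb{RP}^2$ is a pair $(A,a)$, $A$ a point on a line $a$; $F_3$ denotes the set of flags. A quadruple of flags $((A_1,a_1),\dots,(A_4,a_4))$ is positive if, in some affine chart, the lines $a_1,\dots,a_4$ bound a compact convex quadrilateral with sides in cyclic order on $a_1,\dots,a_4$ and each $A_i$ lies in the relative interior of the side on $a_i$. $\mathbb P^1(\mathbb Q)$ carries the cyclic order induced from $\mathbb P^1(\mathbb R)$. A map $\beta:\mathbb P^1(\mathbb Q)\to F_3$ is positive if it sends every cyclically ordered quadruple to a positive quadruple of flags. $\mathcal T_3$ is the set of positive maps modulo the action of $PGL_3(\mathbb R)$ on $F_3$. The Farey triangulation has vertex set $\mathbb P^1(\mathbb Q)$, with $p/q$ and $r/s$ (in lowest terms) joined by an edge iff $|ps-qr|=1$. $I_3$ is the set consisting of one element for each Farey triangle and two elements on each Farey edge (one attached to each endpoint). For $\beta$ with $\beta(y)=(A_y,a_y)$: a Farey triangle with vertices $u,v,w$ in cyclic order gets the triple ratio $\frac{f_{a_u}(\tilde A_v)f_{a_v}(\tilde A_w)f_{a_w}(\tilde A_u)}{f_{a_u}(\tilde A_w)f_{a_v}(\tilde A_u)f_{a_w}(\tilde A_v)}$ ($f_{a}\in(\mathbb R^3)^*$ with kernel the plane of $a$, $\tilde A$ nonzero lift of $A$); a Farey edge $\{u,w\}$,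 diagonal of the quadrilateral $u,v,w,x$ (in cyclic order) formed by the two adjacent Farey triangles, gets at the element attached to $u$ the cross-ratio $\frac{(x_1-x_2)(x_3-x_4)}{(x_1-x_4)(x_2-x_3)}$ of the lines $x_1=a_u,x_2=A_uA_v,x_3=A_uA_w,x_4=A_uA_x$ through $A_u$, and symmetrically at $w$ the cross-ratio of $a_w,A_wA_x,A_wA_u,A_wA_v$. These numbers are $PGL_3(\mathbb R)$-invariant, defining $\varphi_3$. *)

theory Defs
  imports "HOL-Analysis.Analysis"
begin

text \<open>Points of RP^2 are 1-dimensional linear subspaces of R^3, lines of RP^2 are
2-dimensional linear subspaces of R^3. A flag is a pair (A, a) with A contained in a.\<close>

type_synonym flag = "(real^3) set \<times> (real^3) set"

definition is_point :: "(real^3) set \<Rightarrow> bool" where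
  "is_point A \<longleftrightarrow> subspace A \<and> dim A = 1"

definition is_line :: "(real^3) set \<Rightarrow> bool" where
  "is_line a \<longleftrightarrow> subspace a \<and> dim a = 2"

definition is_flag :: "flag \<Rightarrow> bool" where
  "is_flag F \<longleftrightarrow> is_point (fst F) \<and> is_line (snd F) \<and> fst F \<subseteq> snd F"

definition lift :: "(real^3) set \<Rightarrow> real^3" where
  "lift A = (SOME v. v \<in> A \<and> v \<noteq> 0)"

definition nrm :: "(real^3) set \<Rightarrow> real^3" where
  "nrm a = (SOME n. n \<noteq> 0 \<and> (\<forall>x\<in>a. n \<bullet> x = 0))"

definition lf :: "(real^3) set \<Rightarrow> real^3 \<Rightarrow> real" where
  "lf a x = nrm a \<bullet> x"

definition det3 :: "real^3 \<Rightarrow> real^3 \<Rightarrow> real^3 \<Rightarrow> real" where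
  "det3 x y z = det (vector [x, y, z] :: real^3^3)"

definition join :: "(real^3) set \<Rightarrow> (real^3) set \<Rightarrow> (real^3) set" where
  "join P Q = span (P \<union> Q)"

text \<open>Affine chart: the affine plane {x. h . x = 1} (complement of the line at infinity
ker h). Vertices v1..v4 of a compact convex quadrilateral in cyclic order are characterised
by all consecutive triangles having the same (nonzero) orientation; the side on a_i is the
segment [v_i, v_(i+1)] and A_i meets its relative interior.\<close>

definition convex_quad :: "real^3 \<Rightarrow> real^3 \<Rightarrow> real^3 \<Rightarrow> real^3 \<Rightarrow> bool" where
  "convex_quad v1 v2 v3 v4 \<longleftrightarrow>
     (det3 v1 v2 v3 > 0 \<and> det3 v2 v3 v4 > 0 \<and> det3 v3 v4 v1 > 0 \<and> det3 v4 v1 v2 > 0) \<or>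
     (det3 v1 v2 v3 < 0 \<and> det3 v2 v3 v4 < 0 \<and> det3 v3 v4 v1 < 0 \<and> det3 v4 v1 v2 < 0)"

definition side_ok :: "flag \<Rightarrow> real^3 \<Rightarrow> real^3 \<Rightarrow> bool" where
  "side_ok F p q \<longleftrightarrow> p \<in> snd F \<and> q \<in> snd F \<and> (\<exists>w\<in>open_segment p q. w \<in> fst F)"

definition positive_quad :: "flag \<Rightarrow> flag \<Rightarrow> flag \<Rightarrow> flag \<Rightarrow> bool" where
  "positive_quad F1 F2 F3 F4 \<longleftrightarrow>
     (\<exists>h v1 v2 v3 v4. h \<bullet> v1 = 1 \<and> h \<bullet> v2 = 1 \<and> h \<bullet> v3 = 1 \<and> h \<bullet> v4 = 1 \<and>
        convex_quad v1 v2 v3 v4 \<and>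
        side_ok F1 v1 v2 \<and> side_ok F2 v2 v3 \<and> side_ok F3 v3 v4 \<and> side_ok F4 v4 v1)"

text \<open>P^1(Q) is rat option, None being the point at infinity 1/0.\<close>

type_synonym p1q = "rat option"

definition ext_less :: "p1q \<Rightarrow> p1q \<Rightarrow> bool" where
  "ext_less x y = (case (x, y) of
      (Some a, Some b) \<Rightarrow> a < b
    | (Some a, None) \<Rightarrow> True
    | (None, _) \<Rightarrow> False)"

definition cyc3 :: "p1q \<Rightarrow> p1q \<Rightarrow> p1q \<Rightarrow> bool" where
  "cyc3 x1 x2 x3 \<longleftrightarrow>
     (ext_less x1 x2 \<and> ext_less x2 x3) \<or> (ext_less x2 x3 \<and> ext_less x3 x1) \<or>
     (ext_less x3 x1 \<and> ext_less x1 x2)"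

definition cyc4 :: "p1q \<Rightarrow> p1q \<Rightarrow> p1q \<Rightarrow> p1q \<Rightarrow> bool" where
  "cyc4 x1 x2 x3 x4 \<longleftrightarrow>
     (ext_less x1 x2 \<and> ext_less x2 x3 \<and> ext_less x3 x4) \<or>
     (ext_less x2 x3 \<and> ext_less x3 x4 \<and> ext_less x4 x1) \<or>
     (ext_less x3 x4 \<and> ext_less x4 x1 \<and> ext_less x1 x2) \<or>
     (ext_less x4 x1 \<and> ext_less x1 x2 \<and> ext_less x2 x3)"

definition pq :: "p1q \<Rightarrow> int \<times> int" where
  "pq x = (case x of None \<Rightarrow> (1, 0) | Some r \<Rightarrow> quotient_of r)"

definition farey_adj :: "p1q \<Rightarrow> p1q \<Rightarrow> bool" where
  "farey_adj x y \<longleftrightarrow> (let (p, q) = pq x; (r, s) = pq y in \<bar>p * s - q * r\<bar> = 1)"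

definition farey_tri :: "p1q set \<Rightarrow> bool" where
  "farey_tri T \<longleftrightarrow> (\<exists>u v w. T = {u, v, w} \<and> farey_adj u v \<and> farey_adj v w \<and> farey_adj w u)"

text \<open>Index set I_3: one element per Farey triangle, and on each Farey edge {u,w}
one element attached to each endpoint (EdgeI u w is attached to u).\<close>

datatype idx = TriI "p1q set" | EdgeI p1q p1q

definition I3 :: "idx set" where
  "I3 = {TriI T | T. farey_tri T} \<union> {EdgeI u w | u w. farey_adj u w}"

definition positive_map :: "(p1q \<Rightarrow> flag) \<Rightarrow> bool" where
  "positive_map \<beta> \<longleftrightarrow> (\<forall>y. is_flag (\<beta> y)) \<and>
     (\<forall>x1 x2 x3 x4. cyc4 x1 x2 x3 x4 \<longrightarrow> positive_quad (\<beta> x1) (\<beta> x2) (\<beta> x3) (\<beta> x4))"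

definition act :: "real^3^3 \<Rightarrow> flag \<Rightarrow> flag" where
  "act g F = ((\<lambda>x. g *v x) ` fst F, (\<lambda>x. g *v x) ` snd F)"

definition pgl_rel :: "((p1q \<Rightarrow> flag) \<times> (p1q \<Rightarrow> flag)) set" where
  "pgl_rel = {(\<beta>, \<beta>'). positive_map \<beta> \<and> positive_map \<beta>' \<and>
                 (\<exists>g. invertible g \<and> (\<forall>y. \<beta>' y = act g (\<beta> y)))}"

definition T3 :: "(p1q \<Rightarrow> flag) set set" where
  "T3 = {\<beta>. positive_map \<beta>} // pgl_rel"

definition triple_ratio :: "flag \<Rightarrow> flag \<Rightarrow> flag \<Rightarrow> real" where
  "triple_ratio Fu Fv Fw =
     (lf (snd Fu) (lift (fst Fv)) * lf (snd Fv) (lift (fst Fw)) * lf (snd Fw) (lift (fst Fu))) /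
     (lf (snd Fu) (lift (fst Fw)) * lf (snd Fv) (lift (fst Fu)) * lf (snd Fw) (lift (fst Fv)))"

text \<open>Cross-ratio (x1-x2)(x3-x4)/((x1-x4)(x2-x3)) of four lines through the point A,
computed in the pencil of lines through A (lines through A correspond to normal vectors
orthogonal to a lift of A; det3 n_i n_j (lift A) is a nondegenerate alternating form there).\<close>
definition cross_ratio_lines ::
  "(real^3) set \<Rightarrow> (real^3) set \<Rightarrow> (real^3) set \<Rightarrow> (real^3) set \<Rightarrow> (real^3) set \<Rightarrow> real" where
  "cross_ratio_lines A L1 L2 L3 L4 =
     (let d = (\<lambda>L M. det3 (nrm L) (nrm M) (lift A)) in
       (d L1 L2 * d L3 L4) / (d L1 L4 * d L2 L3))"

definition tri_val :: "(p1q \<Rightarrow> flag) \<Rightarrow> p1q set \<Rightarrow> real" where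
  "tri_val \<beta> T = (SOME c. \<exists>u v w. T = {u, v, w} \<and> cyc3 u v w \<and>
                      c = triple_ratio (\<beta> u) (\<beta> v) (\<beta> w))"

definition edge_val :: "(p1q \<Rightarrow> flag) \<Rightarrow> p1q \<Rightarrow> p1q \<Rightarrow> real" where
  "edge_val \<beta> u w = (SOME c. \<exists>v x. farey_tri {u, v, w} \<and> farey_tri {u, w, x} \<and> cyc4 u v w x \<and>
       c = cross_ratio_lines (fst (\<beta> u)) (snd (\<beta> u)) (join (fst (\<beta> u)) (fst (\<beta> v)))
             (join (fst (\<beta> u)) (fst (\<beta> w))) (join (fst (\<beta> u)) (fst (\<beta> x))))"

definition phi_map :: "(p1q \<Rightarrow> flag) \<Rightarrow> idx \<Rightarrow> real" where
  "phi_map \<beta> = restrict (\<lambda>i. case i of TriI T \<Rightarrow> tri_val \<beta> T | EdgeI u w \<Rightarrow> edge_val \<beta> u w) I3"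

definition phi3 :: "(p1q \<Rightarrow> flag) set \<Rightarrow> idx \<Rightarrow> real" where
  "phi3 C = phi_map (SOME \<beta>. \<beta> \<in> C)"

end

(* Choose vectors A_y and covectors n_y representing the flags. A map is positive when the choice can be
made with n_x(A_y) > 0 for x \<noteq> y and det(A_x, A_y, A_z) > 0 for every cyclically ordered triple. In such
lifts every coordinate is a quotient of products of positive numbers. Conversely, across a Farey edge
{u, w} with known third vertex v, the two edge coordinates determine A_x = \<alpha> A_u - A_v + \<gamma> A_w up to scale,
and then the triple ratio determines n_x. The new flag keeps the whole configuration positive, because
for every y on the other side of the edge A_x is a combination of A_u, A_y, A_w with signs +, -, +.
The order in which vertices are attached comes from the quadratic form p^2 - pq + q^2: it is 1 exactly on
the triangle 0, 1, oo, and every other vertex x forms a triangle with exactly one Farey edge whose endpoint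
values add up to less than the value of x. *)
theory Submission
  imports Defs
begin

subsection \<open>Determinants and representatives of flags\<close>

text \<open>The quadratic form is the norm p^2 - pq + q^2 = |p + q*omega|^2 of Eisenstein integers.
  Opposite a Farey edge {u, w} its two values are Q(u) + Q(w) + B and Q(u) + Q(w) - B, where B^2 + 3
  = 4 Q(u) Q(w). So B is odd, never zero, and every edge has a definite side pointing away from the
  base triangle. The same values order the attachments, measure the recursion and carry the
  induction for uniqueness. The obstacle is that positivity speaks of quadruples only, and the
  vectors found for one quadruple need not match those of another. Uniqueness avoids a global
  choice: each step involves four flags and the coordinates are invariant under rescaling. Existence
  must control infinitely many quadruples at once, hence the global lifts with an invariant about
  all pairs and triples. The scale of the new vector is fixed by its coefficient -1 at A_v. This
  carries the determinant across the edge unchanged, so that the edge coordinates become linear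
  equations for the new vector.\<close>

lemma det3_expand: "det3 x y z = x$1*y$2*z$3 + x$2*y$3*z$1 + x$3*y$1*z$2
   - x$1*y$3*z$2 - x$2*y$1*z$3 - x$3*y$2*z$1"
  by (simp add: det3_def det_3 vector_3)

lemma inner3: "(x::real^3) \<bullet> y = x$1*y$1 + x$2*y$2 + x$3*y$3"
  by (simp add: inner_vec_def sum_3)

lemma cramer3: "det3 u v w *\<^sub>R x = det3 x v w *\<^sub>R u + det3 u x w *\<^sub>R v + det3 u v x *\<^sub>R w"
  by (simp add: vec_eq_iff forall_3 det3_expand algebra_simps)

text \<open>The right side is the determinant of the matrix of pairings. It converts positive
  pairings and a positive determinant of points into a positive determinant of normals.\<close>

lemma det3_gram: "det3 k l m * det3 a b c =
   (k \<bullet> a) * ((l \<bullet> b) * (m \<bullet> c) - (l \<bullet> c) * (m \<bullet> b))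
 - (k \<bullet> b) * ((l \<bullet> a) * (m \<bullet> c) - (l \<bullet> c) * (m \<bullet> a))
 + (k \<bullet> c) * ((l \<bullet> a) * (m \<bullet> b) - (l \<bullet> b) * (m \<bullet> a))"
proof -
  have "det3 k l m * det3 a b c = det ((vector [k, l, m] :: real^3^3) ** transpose (vector [a, b, c]))"
    by (simp add: det3_def det_mul det_transpose)
  then show ?thesis
    by (simp add: det_3 matrix_matrix_mult_def transpose_def vector_3 inner_vec_def algebra_simps)
qed

lemma det3_rotate: "det3 y z x = det3 x y z"
  by (simp add: det3_expand)

lemma det3_swap: "det3 y x z = - det3 x y z" "det3 x z y = - det3 x y z" "det3 z y x = - det3 x y z"
  by (simp_all add: det3_expand)

lemma det3_linear:
  "det3 (x + x') y z = det3 x y z + det3 x' y z" "det3 x (y + y') z = det3 x y z + det3 x y' z"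
  "det3 x y (z + z') = det3 x y z + det3 x y z'"
  "det3 (x - x') y z = det3 x y z - det3 x' y z" "det3 x (y - y') z = det3 x y z - det3 x y' z"
  "det3 x y (z - z') = det3 x y z - det3 x y z'"
  "det3 (r *\<^sub>R x) y z = r * det3 x y z" "det3 x (r *\<^sub>R y) z = r * det3 x y z"
  "det3 x y (r *\<^sub>R z) = r * det3 x y z"
  "det3 (- x) y z = - det3 x y z" "det3 x (- y) z = - det3 x y z" "det3 x y (- z) = - det3 x y z"
  by (simp_all add: det3_expand algebra_simps)

lemma det3_same [simp]: "det3 x x y = 0" "det3 x y x = 0" "det3 y x x = 0"
  by (simp_all add: det3_expand)

lemma det3_cross: "x \<bullet> cross3 y z = det3 x y z" "cross3 y z \<bullet> x = det3 x y z"
  by (simp_all add: det3_def dot_cross_det inner_commute)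

text \<open>Covectors are vectors via the inner product. Both \<open>a\<close> and \<open>n\<close>
  are free up to independent nonzero factors, of either sign.\<close>

definition rep :: "flag \<Rightarrow> real^3 \<Rightarrow> real^3 \<Rightarrow> bool" where
  "rep F a n \<longleftrightarrow> a \<noteq> 0 \<and> n \<noteq> 0 \<and> n \<bullet> a = 0 \<and> F = (span {a}, {x. n \<bullet> x = 0})"

lemma rep_scale:
  assumes "rep F a n" "r \<noteq> 0" "s \<noteq> 0"
  shows "rep F (r *\<^sub>R a) (s *\<^sub>R n)"
proof -
  have "span {r *\<^sub>R a} = span {a}"
    using assms(2) span_image_scale[of "{a}" "\<lambda>_. r"] by auto
  then show ?thesis using assms by (auto simp: rep_def)
qed

lemma is_flag_iff_rep: "is_flag F \<longleftrightarrow> (\<exists>a n. rep F a n)"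
proof
  assume F: "is_flag F"
  obtain A L where FA: "F = (A, L)" by (cases F)
  have A: "subspace A" "dim A = 1" and L: "subspace L" "dim L = 2" and "A \<subseteq> L"
    using F by (auto simp: FA is_flag_def is_point_def is_line_def)
  obtain a where a: "a \<in> A" "a \<noteq> 0"
    using A(2) by (metis dim_eq_0 subset_singletonD singletonI subsetI zero_neq_one insertCI)
  have "span {a} = A"
    by (rule subspace_dim_equal) (use a A dim_span[of "{a}"] in \<open>auto simp: span_minimal\<close>)
  obtain n where n: "n \<noteq> 0" "\<forall>x\<in>L. n \<bullet> x = 0"
    using lowdim_subset_hyperplane[of L] L by (auto simp: span_eq_iff[THEN iffD2])
  have "L = {x. n \<bullet> x = 0}"
    by (rule subspace_dim_equal) (use n L in \<open>auto simp: subspace_hyperplane dim_hyperplane\<close>)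
  moreover have "n \<bullet> a = 0" using a(1) n(2) \<open>A \<subseteq> L\<close> by blast
  ultimately have "rep F a n" using a(2) n(1) \<open>span {a} = A\<close> by (simp add: rep_def FA)
  then show "\<exists>a n. rep F a n" by blast
next
  assume "\<exists>a n. rep F a n"
  then obtain a n where r: "rep F a n" by blast
  then have "span {a} \<subseteq> {x. n \<bullet> x = 0}"
    by (intro span_minimal) (auto simp: rep_def subspace_hyperplane)
  then show "is_flag F"
    using r by (auto simp: rep_def is_flag_def is_point_def is_line_def subspace_hyperplane dim_hyperplane)
qed

text \<open>The choices hidden in \<open>lift\<close> and \<open>nrm\<close> matter only up to a
  nonzero factor, which cancels in all the ratios.\<close>

lemma lift_span:
  assumes "a \<noteq> 0" obtains c where "c \<noteq> 0" "lift (span {a}) = c *\<^sub>R a"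
proof -
  have "lift (span {a}) \<in> span {a} \<and> lift (span {a}) \<noteq> 0"
    unfolding lift_def by (rule someI[of _ a]) (use assms in \<open>auto simp: span_base\<close>)
  then show thesis using that by (auto simp: span_singleton)
qed

text \<open>Subtracting from \<open>m\<close> its projection on \<open>n\<close> leaves a vector
  orthogonal to \<open>n\<close>, hence to \<open>m\<close>, hence to itself.\<close>

lemma normal_unique:
  fixes n m :: "real^3"
  assumes "n \<noteq> 0" "m \<noteq> 0" "\<And>x. n \<bullet> x = 0 \<Longrightarrow> m \<bullet> x = 0"
  obtains c where "c \<noteq> 0" "m = c *\<^sub>R n"
proof -
  define c where "c = (m \<bullet> n) / (n \<bullet> n)"
  have "n \<bullet> (m - c *\<^sub>R n) = 0" using assms(1) by (simp add: c_def inner_diff_right inner_commute)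
  then have "n \<bullet> (m - c *\<^sub>R n) = 0" "m \<bullet> (m - c *\<^sub>R n) = 0" using assms(3) by blast+
  then have "(m - c *\<^sub>R n) \<bullet> (m - c *\<^sub>R n) = 0" by (simp add: inner_diff_left)
  then have "m = c *\<^sub>R n" by simp
  with assms(2) show thesis by (intro that[of c]) auto
qed

lemma nrm_hyperplane:
  assumes "n \<noteq> 0" obtains c where "c \<noteq> 0" "nrm {x. n \<bullet> x = 0} = c *\<^sub>R n"
proof -
  have "nrm {x. n \<bullet> x = 0} \<noteq> 0 \<and> (\<forall>x\<in>{x. n \<bullet> x = 0}. nrm {x. n \<bullet> x = 0} \<bullet> x = 0)"
    unfolding nrm_def by (rule someI[of _ n]) (use assms in simp)
  then have "nrm {x. n \<bullet> x = 0} \<noteq> 0" "\<And>x. n \<bullet> x = 0 \<Longrightarrow> nrm {x. n \<bullet> x = 0} \<bullet> x = 0" by blast+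
  then show thesis using normal_unique[OF assms] that by blast
qed

lemma join_eq:
  assumes "cross3 a b \<noteq> 0"
  shows "join (span {a}) (span {b}) = {x. cross3 a b \<bullet> x = 0}"
proof -
  have eq: "join (span {a}) (span {b}) = span {a, b}"
    unfolding join_def span_Un span_span by (simp add: span_Un[symmetric] insert_commute)
  have "a \<noteq> b" using assms by auto
  have "independent {a, b}"
  proof (rule independent_insertI)
    show "a \<notin> span {b}" using assms by (auto simp: span_singleton cross_mult_left)
    show "independent {b}" using assms by auto
  qed
  then have "dim (span {a, b}) = 2" using \<open>a \<noteq> b\<close> by (simp add: dim_eq_card_independent)
  moreover have "span {a, b} \<subseteq> {x. cross3 a b \<bullet> x = 0}"
    by (intro span_minimal) (auto simp: subspace_hyperplane dot_cross_self)
  ultimately show ?thesis unfolding eq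
    by (intro subspace_dim_equal) (use assms in \<open>auto simp: subspace_hyperplane dim_hyperplane\<close>)
qed

lemma lift_rep: "rep F a n \<Longrightarrow> \<exists>c. c \<noteq> 0 \<and> lift (fst F) = c *\<^sub>R a"
  unfolding rep_def by (metis fst_conv lift_span)

lemma nrm_rep: "rep F a n \<Longrightarrow> \<exists>c. c \<noteq> 0 \<and> nrm (snd F) = c *\<^sub>R n"
  unfolding rep_def by (metis snd_conv nrm_hyperplane)

lemma nrm_join_rep:
  assumes "rep F a n" "rep G b m" "cross3 a b \<noteq> 0"
  shows "\<exists>c. c \<noteq> 0 \<and> nrm (join (fst F) (fst G)) = c *\<^sub>R cross3 a b"
proof -
  have "join (fst F) (fst G) = {y. cross3 a b \<bullet> y = 0}"
    using assms by (auto simp: rep_def join_eq)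
  then show ?thesis using nrm_hyperplane[OF assms(3)] by metis
qed

section \<open>Triple ratio and cross-ratio in terms of representatives\<close>

lemma triple_ratio_rep:
  assumes "rep Fu u ku" "rep Fv v kv" "rep Fw w kw"
  shows "triple_ratio Fu Fv Fw = ((ku \<bullet> v) * (kv \<bullet> w) * (kw \<bullet> u)) / ((ku \<bullet> w) * (kv \<bullet> u) * (kw \<bullet> v))"
proof -
  obtain cu cv cw where c: "cu \<noteq> 0" "cv \<noteq> 0" "cw \<noteq> 0"
    "lift (fst Fu) = cu *\<^sub>R u" "lift (fst Fv) = cv *\<^sub>R v" "lift (fst Fw) = cw *\<^sub>R w"
    using assms[THEN lift_rep] by blast
  obtain du dv dw where d: "du \<noteq> 0" "dv \<noteq> 0" "dw \<noteq> 0"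
    "nrm (snd Fu) = du *\<^sub>R ku" "nrm (snd Fv) = dv *\<^sub>R kv" "nrm (snd Fw) = dw *\<^sub>R kw"
    using assms[THEN nrm_rep] by blast
  show ?thesis unfolding triple_ratio_def lf_def c(4-6) d(4-6)
    using c(1-3) d(1-3) by simp
qed

text \<open>In the pencil of lines through \<open>u\<close>, the line \<open>uv\<close> has normal
  \<open>cross3 u v\<close>. Up to the common factor \<open>u \<bullet> u\<close>, which cancels in
  a cross-ratio, the alternating form of the pencil becomes \<open>k \<bullet> v\<close> (when
  \<open>k \<bullet> u = 0\<close>) or \<open>det3 u v w\<close>.\<close>

lemma det3_normals:
  "det3 k (cross3 u v) u = (u \<bullet> u) * (k \<bullet> v) - (u \<bullet> v) * (k \<bullet> u)"
  "det3 (cross3 u v) (cross3 u w) u = (u \<bullet> u) * det3 u v w"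
  by (simp_all add: det3_expand inner3 cross3_def algebra_simps)

lemma cross_ratio_rep:
  assumes "rep Fu u ku" "rep Fv v kv" "rep Fw w kw" "rep Fx x kx"
    and "det3 u v w \<noteq> 0" "det3 u w x \<noteq> 0"
  shows "cross_ratio_lines (fst Fu) (snd Fu) (join (fst Fu) (fst Fv)) (join (fst Fu) (fst Fw))
      (join (fst Fu) (fst Fx)) = ((ku \<bullet> v) * det3 u w x) / ((ku \<bullet> x) * det3 u v w)"
proof -
  have "w \<bullet> cross3 u v = det3 u v w" "w \<bullet> cross3 u x = - det3 u w x" "x \<bullet> cross3 u w = det3 u w x"
    by (simp_all add: det3_cross det3_expand)
  then have ne: "cross3 u v \<noteq> 0" "cross3 u w \<noteq> 0" "cross3 u x \<noteq> 0"
    using assms(5,6) by auto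
  obtain cu du where c: "cu \<noteq> 0" "lift (fst Fu) = cu *\<^sub>R u" "du \<noteq> 0" "nrm (snd Fu) = du *\<^sub>R ku"
    using lift_rep[OF assms(1)] nrm_rep[OF assms(1)] by blast
  obtain ev ew ex where e: "ev \<noteq> 0" "ew \<noteq> 0" "ex \<noteq> 0"
     "nrm (join (fst Fu) (fst Fv)) = ev *\<^sub>R cross3 u v" "nrm (join (fst Fu) (fst Fw)) = ew *\<^sub>R cross3 u w"
     "nrm (join (fst Fu) (fst Fx)) = ex *\<^sub>R cross3 u x"
    using nrm_join_rep[OF assms(1) assms(2) ne(1)] nrm_join_rep[OF assms(1) assms(3) ne(2)]
      nrm_join_rep[OF assms(1) assms(4) ne(3)] by blast
  have u: "u \<noteq> 0" "ku \<bullet> u = 0" using assms(1) by (auto simp: rep_def)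
  show ?thesis unfolding cross_ratio_lines_def Let_def c(2,4) e(4-6) det3_linear det3_normals(2) unfolding det3_normals(1) u(2)
    using u c(1,3) e(1-3) by simp
qed

subsection \<open>Positive quadruples\<close>

text \<open>Cramer's rule for covectors. For \<open>a\<close> on the line with normal
  \<open>l\<close>, only the two intersection points of that line with its neighbours remain, which
  expresses a point of a side by the ends of the side.\<close>

lemma cramer3_dual:
  "det3 k l m *\<^sub>R a = (m \<bullet> a) *\<^sub>R cross3 k l + (k \<bullet> a) *\<^sub>R cross3 l m + (l \<bullet> a) *\<^sub>R cross3 m k"
  by (simp add: vec_eq_iff forall_3 det3_expand inner3 cross3_def algebra_simps)

text \<open>Consecutive vertices of a quadrilateral are cross products of consecutive normals, so
  the orientation of the vertices is read off from the normals.\<close>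

lemma det3_cross_chain:
  "det3 (cross3 k l) (cross3 l m) (cross3 m n) = det3 k l m * det3 l m n"
  by (simp add: det3_expand cross3_def algebra_simps)

text \<open>The matrix of pairings has zero diagonal and positive entries elsewhere. Its determinant
  is the sum of the two terms given by 3-cycles, both even permutations.\<close>

lemma det3_normals_pos:
  assumes "k \<bullet> a = 0" "l \<bullet> b = 0" "m \<bullet> c = 0" "k \<bullet> b > 0" "k \<bullet> c > 0" "l \<bullet> a > 0" "l \<bullet> c > 0"
    "m \<bullet> a > 0" "m \<bullet> b > 0" "det3 a b c > 0"
  shows "det3 k l m > 0"
proof -
  have "det3 k l m * det3 a b c > 0"
    unfolding det3_gram using assms(1-9) by (simp add: add_pos_pos)
  then show ?thesis using assms(10) zero_less_mult_pos2 by blast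
qed

text \<open>A positive combination of \<open>p\<close> and \<open>q\<close> becomes a convex one
  once the ends are rescaled into the chart \<open>h = 1\<close>. The covector \<open>m\<close>
  separates the ends, so the segment is not degenerate.\<close>

lemma side_okI:
  assumes "rep F a n" "s > 0" "t > 0" "d > 0" and eq: "d *\<^sub>R a = s *\<^sub>R p + t *\<^sub>R q"
    and "h \<bullet> p > 0" "h \<bullet> q > 0" "n \<bullet> p = 0" "n \<bullet> q = 0" and m: "m \<bullet> p > 0" "m \<bullet> q = 0"
  shows "side_ok F (p /\<^sub>R (h \<bullet> p)) (q /\<^sub>R (h \<bullet> q))"
proof -
  define e where "e = s * (h \<bullet> p) + t * (h \<bullet> q)"
  have e: "e > 0" using assms by (auto simp: e_def intro!: add_pos_pos)
  \<comment> \<open>Rescaling the ends multiplies the coefficients \<open>s\<close> and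
    \<open>t\<close> by \<open>h \<bullet> p\<close> and \<open>h \<bullet> q\<close>;
    \<open>e\<close> normalises their sum to 1.\<close>
  define u where "u = t * (h \<bullet> q) / e"
  have u: "0 < u" "u < 1" "1 - u = s * (h \<bullet> p) / e"
    using assms e by (auto simp: u_def e_def field_simps)
  have "(1 - u) *\<^sub>R (p /\<^sub>R (h \<bullet> p)) + u *\<^sub>R (q /\<^sub>R (h \<bullet> q)) = (1 / e) *\<^sub>R (s *\<^sub>R p + t *\<^sub>R q)"
    unfolding u(3) using assms(6,7) by (simp add: u_def scaleR_add_right mult.assoc)
  also have "\<dots> = (d / e) *\<^sub>R a" by (simp flip: eq)
  also have "\<dots> \<in> fst F" using assms(1) by (auto simp: rep_def span_singleton)
  finally have "(1 - u) *\<^sub>R (p /\<^sub>R (h \<bullet> p)) + u *\<^sub>R (q /\<^sub>R (h \<bullet> q)) \<in> fst F" .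
  moreover have "p /\<^sub>R (h \<bullet> p) \<noteq> q /\<^sub>R (h \<bullet> q)"
  proof
    assume "p /\<^sub>R (h \<bullet> p) = q /\<^sub>R (h \<bullet> q)"
    then have "m \<bullet> (p /\<^sub>R (h \<bullet> p)) = m \<bullet> (q /\<^sub>R (h \<bullet> q))" by simp
    then show False using m assms(6,7) by simp
  qed
  then have "(1 - u) *\<^sub>R (p /\<^sub>R (h \<bullet> p)) + u *\<^sub>R (q /\<^sub>R (h \<bullet> q))
      \<in> open_segment (p /\<^sub>R (h \<bullet> p)) (q /\<^sub>R (h \<bullet> q))"
    using u(1,2) unfolding in_segment by blast
  ultimately show ?thesis using assms(1,8,9)
    unfolding side_ok_def by (intro conjI bexI) (auto simp: rep_def)
qed

lemma positive_quadI:
  assumes r: "rep F1 a1 n1" "rep F2 a2 n2" "rep F3 a3 n3" "rep F4 a4 n4"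
    and n: "n1 \<bullet> a2 > 0" "n1 \<bullet> a3 > 0" "n1 \<bullet> a4 > 0" "n2 \<bullet> a1 > 0" "n2 \<bullet> a3 > 0" "n2 \<bullet> a4 > 0"
      "n3 \<bullet> a1 > 0" "n3 \<bullet> a2 > 0" "n3 \<bullet> a4 > 0" "n4 \<bullet> a1 > 0" "n4 \<bullet> a2 > 0" "n4 \<bullet> a3 > 0"
    and d: "det3 a1 a2 a3 > 0" "det3 a2 a3 a4 > 0" "det3 a3 a4 a1 > 0" "det3 a4 a1 a2 > 0"
  shows "positive_quad F1 F2 F3 F4"
proof -
  have z: "n1 \<bullet> a1 = 0" "n2 \<bullet> a2 = 0" "n3 \<bullet> a3 = 0" "n4 \<bullet> a4 = 0"
    using r by (auto simp: rep_def)
  have D: "det3 n1 n2 n3 > 0" "det3 n2 n3 n4 > 0" "det3 n3 n4 n1 > 0" "det3 n4 n1 n2 > 0"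
    using det3_normals_pos z n d by blast+
  have D': "det3 n3 n1 n2 > 0" "det3 n4 n2 n3 > 0" "det3 n1 n3 n4 > 0" "det3 n2 n4 n1 > 0"
    using D by (simp_all add: det3_rotate)
  define v1 v2 v3 v4 where v: "v1 = cross3 n4 n1" "v2 = cross3 n1 n2" "v3 = cross3 n2 n3" "v4 = cross3 n3 n4"
  \<comment> \<open>Every vertex lies on two of the four lines and on the positive side of the other
    two, so the sum of the normals is positive at all vertices and serves as the chart.\<close>
  define h where "h = n1 + n2 + n3 + n4"
  have nv: "n1 \<bullet> v1 = 0" "n1 \<bullet> v2 = 0" "n1 \<bullet> v3 > 0" "n1 \<bullet> v4 > 0"
           "n2 \<bullet> v1 > 0" "n2 \<bullet> v2 = 0" "n2 \<bullet> v3 = 0" "n2 \<bullet> v4 > 0"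
           "n3 \<bullet> v1 > 0" "n3 \<bullet> v2 > 0" "n3 \<bullet> v3 = 0" "n3 \<bullet> v4 = 0"
           "n4 \<bullet> v1 = 0" "n4 \<bullet> v2 > 0" "n4 \<bullet> v3 > 0" "n4 \<bullet> v4 = 0"
    unfolding v det3_cross using D D' by (simp_all add: det3_rotate)
  have h: "h \<bullet> v1 > 0" "h \<bullet> v2 > 0" "h \<bullet> v3 > 0" "h \<bullet> v4 > 0"
    using nv by (simp_all add: h_def inner_add_left)
  have a: "det3 n4 n1 n2 *\<^sub>R a1 = (n2 \<bullet> a1) *\<^sub>R v1 + (n4 \<bullet> a1) *\<^sub>R v2"
    "det3 n1 n2 n3 *\<^sub>R a2 = (n3 \<bullet> a2) *\<^sub>R v2 + (n1 \<bullet> a2) *\<^sub>R v3"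
    "det3 n2 n3 n4 *\<^sub>R a3 = (n4 \<bullet> a3) *\<^sub>R v3 + (n2 \<bullet> a3) *\<^sub>R v4"
    "det3 n3 n4 n1 *\<^sub>R a4 = (n1 \<bullet> a4) *\<^sub>R v4 + (n3 \<bullet> a4) *\<^sub>R v1"
    unfolding cramer3_dual v z by simp_all
  note side_okI[OF r(1) n(4) n(10) D(4) a(1) h(1) h(2) nv(1) nv(2) nv(5) nv(6)]
    side_okI[OF r(2) n(8) n(1) D(1) a(2) h(2) h(3) nv(6) nv(7) nv(10) nv(11)]
    side_okI[OF r(3) n(12) n(5) D(2) a(3) h(3) h(4) nv(11) nv(12) nv(15) nv(16)]
    side_okI[OF r(4) n(3) n(9) D(3) a(4) h(4) h(1) nv(16) nv(13) nv(4) nv(1)]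
  moreover have "convex_quad (v1 /\<^sub>R (h \<bullet> v1)) (v2 /\<^sub>R (h \<bullet> v2)) (v3 /\<^sub>R (h \<bullet> v3)) (v4 /\<^sub>R (h \<bullet> v4))"
    unfolding convex_quad_def det3_linear v det3_cross_chain
    by (rule disjI1) (use D h in \<open>simp add: v\<close>)
  ultimately show ?thesis unfolding positive_quad_def using h
    by (intro exI[of _ h] exI[of _ "v1 /\<^sub>R (h \<bullet> v1)"] exI[of _ "v2 /\<^sub>R (h \<bullet> v2)"]
        exI[of _ "v3 /\<^sub>R (h \<bullet> v3)"] exI[of _ "v4 /\<^sub>R (h \<bullet> v4)"]) simp
qed

section \<open>Representatives extracted from a positive quadruple\<close>

lemma det3_eq_0:
  assumes "m \<noteq> 0" "m \<bullet> x = 0" "m \<bullet> y = 0" "m \<bullet> z = 0"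
  shows "det3 x y z = 0"
proof -
  have "det3 x y z * (m \<bullet> m) = m \<bullet> (det3 x y z *\<^sub>R m)" by simp
  also have "\<dots> = 0" unfolding cramer3[of x y z m] using assms by (simp add: inner_add_right)
  finally show ?thesis using assms(1) by simp
qed

text \<open>The chart keeps a convex combination of \<open>p\<close> and \<open>q\<close> away from
  0, so it spans the point of the flag; the line of the flag is the one through \<open>p\<close> and
  \<open>q\<close>.\<close>

lemma side_ok_rep:
  assumes F: "is_flag F" and s: "side_ok F p q" and h: "h \<bullet> p = 1" "h \<bullet> q = 1"
    and ne: "cross3 p q \<noteq> 0"
  obtains s t where "s > 0" "t > 0" "rep F (s *\<^sub>R p + t *\<^sub>R q) (cross3 p q)"
proof -
  obtain a n where r: "rep F a n" using F is_flag_iff_rep by blast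
  obtain u where u: "0 < u" "u < 1" "(1 - u) *\<^sub>R p + u *\<^sub>R q \<in> span {a}"
  proof -
    have "fst F = span {a}" using r by (simp add: rep_def)
    then obtain w where w: "w \<in> open_segment p q" "w \<in> span {a}"
      using s by (metis side_ok_def)
    then obtain u where "0 < u" "u < 1" "w = (1 - u) *\<^sub>R p + u *\<^sub>R q"
      unfolding in_segment by blast
    then show ?thesis using w(2) that by blast
  qed
  have "h \<bullet> ((1 - u) *\<^sub>R p + u *\<^sub>R q) = 1" using h by (simp add: inner_add_right)
  moreover obtain c where c: "(1 - u) *\<^sub>R p + u *\<^sub>R q = c *\<^sub>R a"
    using u(3) unfolding span_singleton by (rule rangeE)
  ultimately have "c \<noteq> 0" unfolding c by (rule_tac notI) simp
  have n: "n \<noteq> 0" "n \<bullet> p = 0" "n \<bullet> q = 0" using r s by (simp_all add: rep_def side_ok_def)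
  have "cross3 p q \<bullet> x = 0" if "n \<bullet> x = 0" for x
    using det3_eq_0[OF n(1) that n(2,3)] by (simp add: det3_cross)
  then obtain d where "d \<noteq> 0" "cross3 p q = d *\<^sub>R n"
    using normal_unique[OF n(1) ne] by blast
  then have "rep F ((1 - u) *\<^sub>R p + u *\<^sub>R q) (cross3 p q)"
    unfolding c using rep_scale[OF r \<open>c \<noteq> 0\<close>] by simp
  then show thesis using u by (intro that[of "1 - u" u]) auto
qed

text \<open>Expanded in the vertices, each quantity is a sum of products of positive weights with
  determinants of three vertices in cyclic order.\<close>

lemma inscribed_pos:
  assumes D: "det3 v1 v2 v3 > 0" "det3 v2 v3 v4 > 0" "det3 v3 v4 v1 > 0" "det3 v4 v1 v2 > 0"
    and p: "p1 > 0" "p2 > 0" "p3 > 0" "p4 > 0" "q1 > 0" "q2 > 0" "q3 > 0" "q4 > 0"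
    and a: "a1 = p1 *\<^sub>R v1 + q1 *\<^sub>R v2" "a2 = p2 *\<^sub>R v2 + q2 *\<^sub>R v3"
      "a3 = p3 *\<^sub>R v3 + q3 *\<^sub>R v4" "a4 = p4 *\<^sub>R v4 + q4 *\<^sub>R v1"
    and n: "n1 = cross3 v1 v2" "n2 = cross3 v2 v3" "n3 = cross3 v3 v4" "n4 = cross3 v4 v1"
  shows "n1 \<bullet> a2 > 0" "n1 \<bullet> a3 > 0" "n1 \<bullet> a4 > 0" "n2 \<bullet> a1 > 0" "n2 \<bullet> a3 > 0" "n2 \<bullet> a4 > 0"
    "n3 \<bullet> a1 > 0" "n3 \<bullet> a2 > 0" "n3 \<bullet> a4 > 0" "n4 \<bullet> a1 > 0" "n4 \<bullet> a2 > 0" "n4 \<bullet> a3 > 0"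
    "det3 a1 a2 a3 > 0" "det3 a2 a3 a4 > 0" "det3 a3 a4 a1 > 0" "det3 a4 a1 a2 > 0"
proof -
  have D': "det3 v3 v1 v2 > 0" "det3 v4 v2 v3 > 0" "det3 v1 v3 v4 > 0" "det3 v2 v4 v1 > 0"
     "det3 v1 v2 v4 > 0" "det3 v2 v3 v1 > 0" "det3 v3 v4 v2 > 0" "det3 v4 v1 v3 > 0"
    using D by (simp_all add: det3_rotate)
  show "n1 \<bullet> a2 > 0" "n1 \<bullet> a3 > 0" "n1 \<bullet> a4 > 0" "n2 \<bullet> a1 > 0" "n2 \<bullet> a3 > 0" "n2 \<bullet> a4 > 0"
    "n3 \<bullet> a1 > 0" "n3 \<bullet> a2 > 0" "n3 \<bullet> a4 > 0" "n4 \<bullet> a1 > 0" "n4 \<bullet> a2 > 0" "n4 \<bullet> a3 > 0"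
    unfolding a n by (simp_all add: inner_add_right det3_cross; intro mult_pos_pos add_pos_pos D D' p)+
  show "det3 a1 a2 a3 > 0" "det3 a2 a3 a4 > 0" "det3 a3 a4 a1 > 0" "det3 a4 a1 a2 > 0"
    unfolding a by (simp_all add: det3_linear; intro mult_pos_pos add_pos_pos D D' p)+
qed

text \<open>A quadrilateral may have either orientation. Negating all four vertices flips every
  triple determinant and leaves the flags and the cross products of neighbours unchanged, so one
  sign convention covers both cases.\<close>

lemma positive_quadE:
  assumes "positive_quad F1 F2 F3 F4" "is_flag F1" "is_flag F2" "is_flag F3" "is_flag F4"
  obtains a1 n1 a2 n2 a3 n3 a4 n4 where
    "rep F1 a1 n1" "rep F2 a2 n2" "rep F3 a3 n3" "rep F4 a4 n4"
    "n1 \<bullet> a2 > 0" "n1 \<bullet> a3 > 0" "n1 \<bullet> a4 > 0" "n2 \<bullet> a1 > 0" "n2 \<bullet> a3 > 0" "n2 \<bullet> a4 > 0"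
    "n3 \<bullet> a1 > 0" "n3 \<bullet> a2 > 0" "n3 \<bullet> a4 > 0" "n4 \<bullet> a1 > 0" "n4 \<bullet> a2 > 0" "n4 \<bullet> a3 > 0"
    "det3 a1 a2 a3 > 0" "det3 a2 a3 a4 > 0" "det3 a3 a4 a1 > 0" "det3 a4 a1 a2 > 0"
proof -
  obtain h v1 v2 v3 v4 where h: "h \<bullet> v1 = 1" "h \<bullet> v2 = 1" "h \<bullet> v3 = 1" "h \<bullet> v4 = 1"
    and cq: "convex_quad v1 v2 v3 v4"
    and s: "side_ok F1 v1 v2" "side_ok F2 v2 v3" "side_ok F3 v3 v4" "side_ok F4 v4 v1"
    using assms(1) unfolding positive_quad_def by blast
  have ne: "cross3 v1 v2 \<noteq> 0" "cross3 v2 v3 \<noteq> 0" "cross3 v3 v4 \<noteq> 0" "cross3 v4 v1 \<noteq> 0"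
    using cq det3_cross(1)[of v4 v1 v2] det3_cross(1)[of v1 v2 v3] det3_cross(1)[of v2 v3 v4]
      det3_cross(1)[of v3 v4 v1] by (auto simp: convex_quad_def)
  obtain p1 q1 where r1: "p1 > 0" "q1 > 0" "rep F1 (p1 *\<^sub>R v1 + q1 *\<^sub>R v2) (cross3 v1 v2)"
    using side_ok_rep[OF assms(2) s(1) h(1,2) ne(1)] by blast
  obtain p2 q2 where r2: "p2 > 0" "q2 > 0" "rep F2 (p2 *\<^sub>R v2 + q2 *\<^sub>R v3) (cross3 v2 v3)"
    using side_ok_rep[OF assms(3) s(2) h(2,3) ne(2)] by blast
  obtain p3 q3 where r3: "p3 > 0" "q3 > 0" "rep F3 (p3 *\<^sub>R v3 + q3 *\<^sub>R v4) (cross3 v3 v4)"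
    using side_ok_rep[OF assms(4) s(3) h(3,4) ne(3)] by blast
  obtain p4 q4 where r4: "p4 > 0" "q4 > 0" "rep F4 (p4 *\<^sub>R v4 + q4 *\<^sub>R v1) (cross3 v4 v1)"
    using side_ok_rep[OF assms(5) s(4) h(4,1) ne(4)] by blast
  have neg_rep: "rep F (p *\<^sub>R (- x) + q *\<^sub>R (- y)) (cross3 (- x) (- y))"
    if "rep F (p *\<^sub>R x + q *\<^sub>R y) (cross3 x y)" for F p q x y
    using rep_scale[OF that, of "-1" 1] by (simp add: cross_minus_left cross_minus_right)
  have minus: "det3 (- x) (- y) (- z) > 0 \<longleftrightarrow> det3 x y z < 0" for x y z
    by (simp add: det3_linear)
  consider (pos) "det3 v1 v2 v3 > 0" "det3 v2 v3 v4 > 0" "det3 v3 v4 v1 > 0" "det3 v4 v1 v2 > 0"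
    | (neg) "det3 (-v1) (-v2) (-v3) > 0" "det3 (-v2) (-v3) (-v4) > 0" "det3 (-v3) (-v4) (-v1) > 0"
       "det3 (-v4) (-v1) (-v2) > 0"
    using cq unfolding convex_quad_def minus by blast
  then show thesis
  proof cases
    case pos
    show ?thesis
      by (rule that[OF r1(3) r2(3) r3(3) r4(3) inscribed_pos[OF pos r1(1) r2(1) r3(1) r4(1)
            r1(2) r2(2) r3(2) r4(2) refl refl refl refl refl refl refl refl]])
  next
    case neg
    show ?thesis
      by (rule that[OF r1(3)[THEN neg_rep] r2(3)[THEN neg_rep] r3(3)[THEN neg_rep] r4(3)[THEN neg_rep]
            inscribed_pos[OF neg r1(1) r2(1) r3(1) r4(1)
            r1(2) r2(2) r3(2) r4(2) refl refl refl refl refl refl refl refl]])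
  qed
qed

subsection \<open>The Farey triangulation\<close>

definition pnum :: "p1q \<Rightarrow> int" where "pnum x = fst (pq x)"
definition pden :: "p1q \<Rightarrow> int" where "pden x = snd (pq x)"

definition dt :: "p1q \<Rightarrow> p1q \<Rightarrow> int" where
  "dt x y = pnum x * pden y - pden x * pnum y"

definition Qf :: "p1q \<Rightarrow> int" where
  "Qf x = pnum x ^ 2 - pnum x * pden x + pden x ^ 2"

text \<open>The polar form of \<open>Qf\<close>: the value at the sum of two integer vectors is the
  sum of their values plus \<open>Bf\<close>.\<close>

definition Bf :: "p1q \<Rightarrow> p1q \<Rightarrow> int" where
  "Bf x y = 2 * pnum x * pnum y - pnum x * pden y - pden x * pnum y + 2 * pden x * pden y"

lemma coprime_pq: "coprime (pnum x) (pden x)"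
  by (cases x) (simp_all add: pnum_def pden_def pq_def quotient_of_coprime prod_eq_iff)

text \<open>A primitive vector and its negative give the same point, and \<open>pq\<close> selects
  one of them; \<open>e\<close> records which.\<close>

lemma pq_surj:
  assumes "coprime p q"
  obtains x e where "e = 1 \<or> e = - 1" "pnum x = e * p" "pden x = e * q"
proof -
  consider "q = 0" "p = 1" | "q = 0" "p = -1" | "q > 0" | "q < 0"
    using assms by (cases q "0 :: int" rule: linorder_cases) (auto simp: abs_eq_iff')
  then show thesis
  proof cases
    case 1 then show thesis by (intro that[of 1 None]) (auto simp: pnum_def pden_def pq_def)
  next
    case 2 then show thesis by (intro that[of "-1" None]) (auto simp: pnum_def pden_def pq_def)
  next
    case 3
    have "quotient_of (Fract p q) = (p, q)"
      using assms 3 by (simp add: quotient_of_Fract Rat.normalize_def Let_def coprime_iff_gcd_eq_1)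
    then show thesis by (intro that[of 1 "Some (Fract p q)"]) (auto simp: pnum_def pden_def pq_def)
  next
    case 4
    have "quotient_of (Fract p q) = (-p, -q)"
      using assms 4 by (simp add: quotient_of_Fract Rat.normalize_def Let_def coprime_iff_gcd_eq_1)
    then show thesis by (intro that[of "-1" "Some (Fract p q)"]) (auto simp: pnum_def pden_def pq_def)
  qed
qed

section \<open>Order, cyclic order and adjacency through determinants\<close>

lemma ext_less_iff: "ext_less x y \<longleftrightarrow> dt x y < 0"
proof (cases x; cases y)
  fix a b assume "x = Some a" "y = Some b"
  then show ?thesis
    by (simp add: ext_less_def dt_def pnum_def pden_def pq_def rat_less_code split: prod.splits)
qed (auto simp: ext_less_def dt_def pnum_def pden_def pq_def quotient_of_denom_pos'
  leD[OF less_imp_le[OF quotient_of_denom_pos']])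

lemma ext_less_linear: "ext_less x y \<or> x = y \<or> ext_less y x"
  by (auto simp: ext_less_def split: option.splits)

lemma dt_skew: "dt y x = - dt x y" by (simp add: dt_def)

lemma dt_self [simp]: "dt x x = 0" by (simp add: dt_def)

lemma dt_eq_0_iff [simp]: "dt x y = 0 \<longleftrightarrow> x = y"
  using ext_less_linear[of x y] ext_less_iff[of x y] ext_less_iff[of y x] dt_skew[of y x] by auto

lemma farey_adj_iff: "farey_adj x y \<longleftrightarrow> \<bar>dt x y\<bar> = 1"
  by (simp add: farey_adj_def dt_def pnum_def pden_def split: prod.splits)

lemma farey_adj_sym: "farey_adj x y \<longleftrightarrow> farey_adj y x"
  by (simp add: farey_adj_iff dt_skew[of y x])

lemma farey_adj_neq: "farey_adj x y \<Longrightarrow> x \<noteq> y"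
  by (auto simp: farey_adj_iff dt_def)

lemma cyc3_rotate: "cyc3 x y z \<longleftrightarrow> cyc3 y z x"
  by (auto simp: cyc3_def)

text \<open>Each point enters two factors, so the product ignores the sign of its integer vector.
  For a linear order the three differences around a triple are never all positive; a positive
  product means exactly two negative ones.\<close>

lemma cyc3_iff: "cyc3 x y z \<longleftrightarrow> dt x y * dt y z * dt z x > 0"
proof -
  have tr: "ext_less a b \<Longrightarrow> ext_less b c \<Longrightarrow> ext_less a c" for a b c
    by (auto simp: ext_less_def split: option.splits)
  have tr': "dt a b < 0 \<Longrightarrow> dt b c < 0 \<Longrightarrow> dt c a > 0" for a b c
    using tr[of a b c] dt_skew[of c a] by (simp add: ext_less_iff)
  have no: "\<not> (dt x y > 0 \<and> dt y z > 0 \<and> dt z x > 0)"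
    using tr[of z y x] by (auto simp: ext_less_iff dt_skew[of y x] dt_skew[of z y] dt_skew[of z x])
  show ?thesis
    using tr'[of x y z] tr'[of y z x] tr'[of z x y] no
    unfolding cyc3_def ext_less_iff zero_less_mult_iff mult_less_0_iff by linarith
qed

lemma cyc3_total: "x \<noteq> y \<Longrightarrow> y \<noteq> z \<Longrightarrow> z \<noteq> x \<Longrightarrow> cyc3 x y z \<or> cyc3 z y x"
  using ext_less_linear[of x y] ext_less_linear[of y z] ext_less_linear[of z x]
  by (auto simp: cyc3_def)

lemma cyc3_neq: "cyc3 x y z \<Longrightarrow> x \<noteq> y \<and> y \<noteq> z \<and> z \<noteq> x"
  by (auto simp: cyc3_iff)

lemma cyc3_asym: "cyc3 x y z \<Longrightarrow> \<not> cyc3 z y x"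
  by (auto simp: cyc3_def ext_less_def split: option.splits)

lemma cyc4_imp_cyc3:
  assumes "cyc4 a b c d"
  shows "cyc3 a b c" "cyc3 b c d" "cyc3 c d a" "cyc3 d a b"
  using assms unfolding cyc4_def cyc3_def by (auto simp: ext_less_def split: option.splits)

lemma cyc4I: "cyc3 a b c \<Longrightarrow> cyc3 c d a \<Longrightarrow> cyc4 a b c d"
  unfolding cyc4_def cyc3_def by (auto simp: ext_less_def split: option.splits)

text \<open>With \<open>y\<close>, \<open>z\<close> on the arc cut off by the chord
  \<open>uw\<close> and \<open>x\<close> beyond the chord, moving \<open>x\<close> to either end of
  the chord does not change the cyclic order.\<close>

lemma cyc3_nested:
  assumes "cyc3 u y w" "cyc3 u z w" "cyc3 w x u" "cyc3 y z x"
  shows "cyc3 y z u" "cyc3 y z w"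
proof -
  have "ext_less a b \<Longrightarrow> ext_less b c \<Longrightarrow> ext_less a c" "\<not> ext_less a a" for a b c
    by (auto simp: ext_less_def split: option.splits)
  then show "cyc3 y z u" "cyc3 y z w"
    using assms unfolding cyc3_def by (smt (verit))+
qed

text \<open>Seen from \<open>x\<close>, the closed arc starts at \<open>u\<close> and stops at
  \<open>w\<close>; since \<open>y\<close> precedes \<open>z\<close> there, \<open>y\<close> is not
  its last point and \<open>z\<close> is not its start.\<close>

lemma cyc3_chord:
  assumes "cyc3 w x u" "cyc3 y z x" "y = u \<or> y = w \<or> cyc3 u y w" "z = u \<or> z = w \<or> cyc3 u z w"
  shows "y \<noteq> w" "z \<noteq> u"
proof -
  have "ext_less a b \<Longrightarrow> ext_less b c \<Longrightarrow> ext_less a c" "\<not> ext_less a a" for a b c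
    by (auto simp: ext_less_def split: option.splits)
  then show "y \<noteq> w" "z \<noteq> u"
    using assms unfolding cyc3_def by (smt (verit))+
qed

lemma Qf_pos: "Qf x \<ge> 1"
proof -
  have "pnum x \<noteq> 0 \<or> pden x \<noteq> 0" using coprime_pq[of x] by auto
  moreover have "4 * Qf x = (2 * pnum x - pden x)^2 + 3 * (pden x)^2"
    by (simp add: Qf_def power2_eq_square algebra_simps)
  ultimately have "4 * Qf x > 0"
    by (metis add_nonneg_pos add_pos_nonneg diff_zero mult_eq_0_iff mult_pos_pos mult_zero_right
        power_zero_numeral zero_le_power2 zero_less_numeral zero_less_power2 add.right_neutral zero_neq_numeral)
  then show ?thesis by simp
qed

text \<open>The form has discriminant -3. On a Farey edge \<open>dt\<close> is 1 or -1, so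
  \<open>Bf\<close> is odd and in particular nonzero.\<close>

lemma Bf_discriminant: "(Bf u w)^2 + 3 * (dt u w)^2 = 4 * Qf u * Qf w"
  unfolding Bf_def dt_def Qf_def by algebra

lemma Bf_sym: "Bf u w = Bf w u" by (simp add: Bf_def)

text \<open>Here \<open>(a y, b y)\<close> are the coordinates of \<open>y\<close> in the integral basis formed by the edge.\<close>

lemma edge_coords:
  assumes "farey_adj u w"
  defines "a y \<equiv> dt y w * dt u w" and "b y \<equiv> dt u y * dt u w"
  shows "pnum y = a y * pnum u + b y * pnum w" "pden y = a y * pden u + b y * pden w"
    "Qf y = (a y)^2 * Qf u + a y * b y * Bf u w + (b y)^2 * Qf w"
    "dt y z = (a y * b z - b y * a z) * dt u w"
    "dt u y = b y * dt u w" "dt y w = a y * dt u w"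
proof -
  have d: "dt u w * dt u w = 1"
    using assms(1) by (metis farey_adj_iff abs_mult_self_eq mult_1)
  have e0: "pnum y * (dt u w * dt u w) = a y * pnum u + b y * pnum w"
    "pden y * (dt u w * dt u w) = a y * pden u + b y * pden w" for y
    unfolding a_def b_def dt_def by (simp_all add: algebra_simps)
  note e = e0[unfolded d mult_1_right]
  show "pnum y = a y * pnum u + b y * pnum w" "pden y = a y * pden u + b y * pden w" by (rule e)+
  show "Qf y = (a y)^2 * Qf u + a y * b y * Bf u w + (b y)^2 * Qf w"
    unfolding Qf_def Bf_def e[of y] by (simp add: power2_eq_square algebra_simps)
  show "dt y z = (a y * b z - b y * a z) * dt u w"
    unfolding dt_def[of y z] e[of y] e[of z] by (simp add: dt_def algebra_simps)
  show "dt u y = b y * dt u w" "dt y w = a y * dt u w"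
    using d by (simp_all add: a_def b_def mult.assoc)
qed

text \<open>The common neighbour of \<open>u\<close> and \<open>w\<close> on the arc from \<open>u\<close> to \<open>w\<close>; the one on the other side is
\<open>third w u\<close>.\<close>

definition third :: "p1q \<Rightarrow> p1q \<Rightarrow> p1q" where
  "third u w = (THE v. farey_adj u v \<and> farey_adj w v \<and> cyc3 u v w)"

lemma abs1_sq: "\<bar>i::int\<bar> = 1 \<Longrightarrow> i * i = 1"
  by (metis abs_mult_self_eq mult_1)

text \<open>In the basis of the edge, a common neighbour has both coordinates 1 or -1, and the side
  of the edge fixes their relative sign.\<close>

lemma third_unique:
  assumes uw: "farey_adj u w"
    and v: "farey_adj u v" "farey_adj w v" "cyc3 u v w"
    and v': "farey_adj u v'" "farey_adj w v'" "cyc3 u v' w"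
  shows "v = v'"
proof -
  have d: "dt u w = 1 \<or> dt u w = - 1" using uw by (auto simp: farey_adj_iff)
  have "dt u v = 1 \<or> dt u v = - 1" "dt w v = 1 \<or> dt w v = - 1"
    "dt u v' = 1 \<or> dt u v' = - 1" "dt w v' = 1 \<or> dt w v' = - 1"
    using v v' by (auto simp: farey_adj_iff)
  then have "dt v v' = 0"
    using d v(3) v'(3) edge_coords(4)[OF uw, of v v']
    unfolding cyc3_iff dt_skew[of w u] dt_skew[of v w] dt_skew[of v' w]
    by (elim disjE) simp_all
  then show ?thesis by simp
qed

lemma third_eqI:
  "farey_adj u w \<Longrightarrow> farey_adj u v \<Longrightarrow> farey_adj w v \<Longrightarrow> cyc3 u v w \<Longrightarrow> third u w = v"
  unfolding third_def by (rule the_equality) (auto intro: third_unique)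

lemma third_props:
  assumes uw: "farey_adj u w"
  shows "farey_adj u (third u w)" "farey_adj w (third u w)" "cyc3 u (third u w) w"
    "Qf (third u w) = Qf u + Qf w - dt u w * Bf u w"
proof -
  \<comment> \<open>The two candidates are u + w and u - w as integer vectors; this sign selects the
    one on the arc from \<open>u\<close> to \<open>w\<close>.\<close>
  define s where "s = - dt u w"
  have d: "dt u w * dt u w = 1" using uw by (auto simp: farey_adj_iff abs1_sq)
  have ds: "\<bar>s\<bar> = 1" "s * s = 1" using uw d by (auto simp: farey_adj_iff s_def)
  define p q where "p = pnum u + s * pnum w" and "q = pden u + s * pden w"
  have "p * pden w - q * pnum w = dt u w" by (simp add: p_def q_def dt_def algebra_simps)
  then have "dt u w * (p * pden w - q * pnum w) = 1" using d by simp
  then have "coprime p q"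
    by (intro coprimeI) (metis dvd_diff dvd_mult dvd_mult2 mult.commute)
  then obtain v e where e: "e = 1 \<or> e = - 1" "pnum v = e * p" "pden v = e * q"
    by (rule pq_surj)
  have e2: "e * e = 1" using e(1) by auto
  have uv: "dt u v = e * s * dt u w" and vw: "dt v w = e * dt u w"
    unfolding dt_def e p_def q_def by (simp_all add: algebra_simps)
  have "farey_adj u v" "farey_adj w v"
    using e(1) ds uw unfolding farey_adj_iff dt_skew[of w v] uv vw by (auto simp: abs_mult)
  moreover have "cyc3 u v w"
  proof -
    have "dt u v * dt v w * dt w u = (e * e) * (s * s) * (dt u w * dt u w)"
      unfolding uv vw dt_skew[of w u] by (simp add: s_def)
    then show ?thesis unfolding cyc3_iff e2 ds d by simp
  qed
  moreover have "Qf v = Qf u + Qf w - dt u w * Bf u w"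
  proof -
    have "Qf v = (e * e) * Qf u + (e * e) * (s * s) * Qf w + (e * e) * s * Bf u w"
      unfolding Qf_def Bf_def e p_def q_def by (simp add: power2_eq_square algebra_simps)
    then show ?thesis unfolding e2 ds by (simp add: s_def)
  qed
  ultimately show "farey_adj u (third u w)" "farey_adj w (third u w)" "cyc3 u (third u w) w"
    "Qf (third u w) = Qf u + Qf w - dt u w * Bf u w"
    using third_eqI[OF uw] by auto
qed

lemma third_cyc4: "farey_adj u w \<Longrightarrow> cyc4 u (third u w) w (third w u)"
  using third_props(3)[of u w] third_props(3)[of w u] by (intro cyc4I) (auto simp: farey_adj_sym)

section \<open>Parent edges and descent along the quadratic form\<close>

lemma Qf_third_sum:
  assumes "farey_adj u w"
  shows "Qf (third u w) + Qf (third w u) = 2 * Qf u + 2 * Qf w"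
  using third_props(4)[OF assms] third_props(4)[of w u] assms
  by (simp add: farey_adj_sym[of w u] dt_skew[of w u] Bf_sym[of w u])

text \<open>The edge is oriented so that \<open>x\<close> lies on the arc from \<open>w\<close> to
  \<open>u\<close>. By the parallelogram law \<open>Qf_third_sum\<close>, the inequality also bounds
  the value at the opposite vertex \<open>third u w\<close>, so all three vertices needed to attach
  \<open>x\<close> precede it.\<close>

definition parent :: "p1q \<Rightarrow> p1q \<Rightarrow> p1q \<Rightarrow> bool" where
  "parent x u w \<longleftrightarrow> farey_adj u w \<and> third w u = x \<and> Qf u + Qf w < Qf x"

lemma parentD:
  assumes "parent x u w"
  shows "farey_adj u w" "third w u = x" "Qf u < Qf x" "Qf w < Qf x" "Qf (third u w) < Qf x"
    "farey_adj u x" "farey_adj w x" "cyc3 w x u"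
  using assms Qf_pos[of u] Qf_pos[of w] Qf_third_sum[of u w] third_props[of w u]
  by (auto simp: parent_def farey_adj_sym[of u w])

text \<open>Write \<open>y\<close> in the basis of the edge. On the side of \<open>x\<close> the
  mixed term of \<open>Qf y\<close> is a positive multiple of the one in \<open>Qf x\<close>, so
  \<open>Qf y \<ge> Qf x\<close>, with equality only if both coordinates are 1 or -1, and that is
  \<open>x\<close> itself. Vertices attached earlier therefore all lie across the parent
  edge.\<close>

lemma parent_arc:
  assumes p: "parent x u w" and y: "y \<noteq> u" "y \<noteq> w" "y \<noteq> x" "Qf y \<le> Qf x"
  shows "cyc3 u y w"
proof (rule ccontr)
  assume "\<not> cyc3 u y w"
  then have c: "cyc3 w y u" using cyc3_total[of u y w] y farey_adj_neq[OF parentD(1)[OF p]] by auto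
  note uw = parentD(1)[OF p]
  define a b where "a = dt y w * dt u w" and "b = dt u y * dt u w"
  have d: "dt u w * dt u w = 1" using uw by (auto simp: farey_adj_iff abs1_sq)
  have E: "Qf y = a^2 * Qf u + a * b * Bf u w + b^2 * Qf w" "dt u y = b * dt u w" "dt y w = a * dt u w"
    unfolding a_def b_def by (rule edge_coords[OF uw])+
  define m where "m = a * b * dt u w"
  have ab: "a * b = m * dt u w" using d by (simp add: m_def mult.assoc)
  have "dt w y * dt y u * dt u w = a * b * dt u w * (dt u w * dt u w)"
    unfolding dt_skew[of w y] dt_skew[of y u] E by simp
  then have "m > 0" using c unfolding cyc3_iff d m_def mult_1_right by (simp only:)
  then have m: "m \<ge> 1" by simp
  define k where "k = dt u w * Bf u w"
  have Qx: "Qf x = Qf u + Qf w + k"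
    using third_props(4)[of w u] uw parentD(2)[OF p]
    by (simp add: farey_adj_sym[of w u] dt_skew[of w u] Bf_sym[of w u] k_def)
  then have k: "k > 0" using p by (simp add: parent_def)
  have Qy: "Qf y = a^2 * Qf u + m * k + b^2 * Qf w"
    unfolding E(1) ab k_def by simp
  have nz: "a \<noteq> 0" "b \<noteq> 0" using m by (auto simp: m_def)
  then have a: "a^2 \<ge> 1" and b: "b^2 \<ge> 1" by (simp_all add: int_one_le_iff_zero_less)
  have "m * k \<ge> k" using m k by simp
  moreover have "a^2 * Qf u \<ge> Qf u" "b^2 * Qf w \<ge> Qf w"
    using a b Qf_pos[of u] Qf_pos[of w] by simp_all
  ultimately have "a^2 * Qf u = Qf u" "b^2 * Qf w = Qf w" using Qy Qx y(4) by linarith+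
  then have "a^2 = 1" "b^2 = 1" using Qf_pos[of u] Qf_pos[of w] by auto
  then have "\<bar>a\<bar> = 1" "\<bar>b\<bar> = 1" by (auto simp: power2_eq_1_iff)
  then have "farey_adj w y" "farey_adj u y"
    using uw unfolding farey_adj_iff dt_skew[of w y] E by (auto simp: abs_mult)
  then have "third w u = y" using c uw by (intro third_eqI) (auto simp: farey_adj_sym)
  then show False using parentD(2)[OF p] y by simp
qed

text \<open>Otherwise \<open>y\<close> lies across the edge by \<open>parent_arc\<close>, and the
  two terms in the edge expansion of \<open>dt y x\<close> reinforce each other: its absolute value
  is the sum of those of the coordinates of \<open>y\<close>, at least 2.\<close>

lemma parent_neighbour:
  assumes p: "parent x u w" and y: "farey_adj y x" "Qf y < Qf x"
  shows "y = u \<or> y = w"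
proof (rule ccontr)
  assume *: "\<not> (y = u \<or> y = w)"
  note uw = parentD(1)[OF p]
  have "y \<noteq> x" using y(2) by auto
  then have "cyc3 u y w" using parent_arc[OF p, of y] * y(2) by simp
  define a b where "a = dt y w * dt u w" and "b = dt u y * dt u w"
  define a' b' where "a' = dt x w * dt u w" and "b' = dt u x * dt u w"
  have d: "dt u w = 1 \<or> dt u w = - 1" using uw by (auto simp: farey_adj_iff)
  have E: "dt y x = (a * b' - b * a') * dt u w" "dt u y = b * dt u w" "dt y w = a * dt u w"
     "dt u x = b' * dt u w" "dt x w = a' * dt u w"
    unfolding a_def b_def a'_def b'_def by (rule edge_coords[OF uw])+
  have x: "\<bar>dt u x\<bar> = 1" "\<bar>dt x w\<bar> = 1" "dt w x * dt x u * dt u w > 0" "\<bar>dt y x\<bar> = 1"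
    using parentD[OF p] y(1) by (auto simp: farey_adj_iff dt_skew[of w x] cyc3_iff)
  have "a' = 1 \<or> a' = -1" "b' = 1 \<or> b' = -1" using x(1,2) d unfolding E by auto
  moreover have "dt u y * dt y w * dt w u > 0" using \<open>cyc3 u y w\<close> by (simp add: cyc3_iff)
  then have "a * b * dt u w < 0" using d unfolding E dt_skew[of w u] by (auto simp: mult.commute)
  then have "(a \<ge> 1 \<and> b * dt u w \<le> -1) \<or> (a \<le> -1 \<and> b * dt u w \<ge> 1)"
    unfolding mult.assoc mult_less_0_iff[of a] by linarith
  ultimately show False using d x(3,4) unfolding E dt_skew[of w x] dt_skew[of x u]
    by (elim disjE) auto
qed

text \<open>\<open>parent_neighbour\<close> fixes the set of endpoints. The reversed orientation
  would make \<open>x\<close> equal to \<open>third u w\<close>, whose value is smaller.\<close>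

lemma parent_unique:
  assumes p: "parent x u w" and p': "parent x u' w'"
  shows "u = u'" "w = w'"
proof -
  have "u' = u \<or> u' = w" "w' = u \<or> w' = w"
    using parent_neighbour[OF p] parentD[OF p'] by (auto simp: farey_adj_sym)
  moreover have "u' \<noteq> w'" using farey_adj_neq[OF parentD(1)[OF p']] .
  moreover have "\<not> (u' = w \<and> w' = u)"
    using parentD(2,5)[OF p] parentD(2)[OF p'] by auto
  ultimately show "u = u'" "w = w'" by auto
qed

lemma parentI:
  assumes "farey_adj u w" "farey_adj u x" "farey_adj w x" "Qf u + Qf w < Qf x"
  shows "parent x u w \<or> parent x w u"
proof -
  have "cyc3 w x u \<or> cyc3 u x w"
    using cyc3_total[of w x u] farey_adj_neq assms by blast
  then show ?thesis
    using third_eqI[of w u x] third_eqI[of u w x] assms by (auto simp: parent_def farey_adj_sym)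
qed

text \<open>The ends sought are integer vectors (p, q) and (X - p, Y - q) with sum (X, Y) and
  determinant 1. Their values add up to \<open>2 * qu + n - b\<close>, so the aim is
  \<open>2 * qu < b\<close>.\<close>

lemma parent_exists:
  assumes "Qf x > 1"
  obtains u w where "parent x u w"
proof -
  define X Y where "X = pnum x" "Y = pden x"
  define n where "n = Qf x"
  obtain s t where st: "s * X + t * Y = 1"
    using coprime_pq[of x] bezout_int[of X Y] by (auto simp: X_Y_def coprime_iff_gcd_eq_1)
  define b0 where "b0 = 2 * t * X - t * Y + s * X - 2 * s * Y"
  \<comment> \<open>Adding k times (X, Y) to a Bezout solution keeps the determinant and changes the
    polar form by 2kn, so it can be reduced into the range from 0 to 2n - 1.\<close>
  define k where "k = - (b0 div (2 * n))"
  define p q where "p = t + k * X" and "q = - s + k * Y"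
  define b where "b = 2 * p * X - p * Y - q * X + 2 * q * Y"
  have det: "p * Y - q * X = 1" using st by (simp add: p_def q_def algebra_simps)
  have nXY: "n = X^2 - X * Y + Y^2" by (simp add: n_def Qf_def X_Y_def)
  have "b = b0 + k * (2 * n)"
    by (simp add: b_def b0_def p_def q_def nXY power2_eq_square algebra_simps)
  also have "\<dots> = b0 mod (2 * n)" by (simp add: k_def minus_div_mult_eq_mod[symmetric])
  finally have bn: "0 \<le> b" "b < 2 * n" using assms by (simp_all add: n_def)
  define qu where "qu = p^2 - p * q + q^2"
  have disc: "b^2 + 3 * (p * Y - q * X)^2 = 4 * qu * n"
    unfolding b_def qu_def nXY by algebra
  have n3: "n \<ge> 3"
  proof (rule ccontr)
    assume "\<not> n \<ge> 3"
    then have n2: "n = 2" using assms by (simp add: n_def)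
    \<comment> \<open>For n = 2 the discriminant identity says that b^2 + 3 is divisible by 8, which
      none of the four values satisfies.\<close>
    then have "b = 0 \<or> b = 1 \<or> b = 2 \<or> b = 3" using bn by auto
    then show False using disc det n2 by auto presburger+
  qed
  \<comment> \<open>By the discriminant identity this amounts to \<open>b * (2 * n - b) > 3\<close>;
    the product is smallest at the ends of the range, where it is 2n - 1.\<close>
  have "4 * qu * n < 2 * b * n"
  proof -
    have "b \<noteq> 0"
    proof
      assume "b = 0"
      then have "3 = 4 * (qu * n)" using disc det by simp
      then show False by presburger
    qed
    then have "1 * (2 * n - 1) \<le> b * (2 * n - b)"
    proof -
      have "(b - 1) * (2 * n - b - 1) \<ge> 0" using bn \<open>b \<noteq> 0\<close> by simp
      then show ?thesis by (simp add: algebra_simps)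
    qed
    then have "b * (2 * n - b) > 3" using n3 by simp
    then have "b^2 + 3 < 2 * b * n" by (simp add: power2_eq_square algebra_simps)
    then show ?thesis using disc det by simp
  qed
  then have qb: "2 * qu < b" using n3 by simp
  have "coprime p q"
    using det by (intro coprimeI) (metis dvd_diff dvd_mult dvd_mult2)
  then obtain u e where e: "e = 1 \<or> e = - 1" "pnum u = e * p" "pden u = e * q" by (rule pq_surj)
  have det': "p * (Y - q) - q * (X - p) = 1" using det by (simp add: algebra_simps)
  have "coprime (X - p) (Y - q)"
    using det' by (intro coprimeI) (metis dvd_diff dvd_mult dvd_mult2)
  then obtain w f where f: "f = 1 \<or> f = - 1" "pnum w = f * (X - p)" "pden w = f * (Y - q)"
    by (rule pq_surj)
  have "dt u w = e * f * (p * (Y - q) - q * (X - p))" "dt u x = e * (p * Y - q * X)"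
    "dt w x = - f * (p * Y - q * X)"
    unfolding dt_def e f X_Y_def by (simp_all add: algebra_simps)
  then have "farey_adj u w" "farey_adj u x" "farey_adj w x"
    using e(1) f(1) unfolding farey_adj_iff det det' by (auto simp: abs_mult)
  moreover have "Qf u + Qf w < Qf x"
  proof -
    have "e * e = 1" "f * f = 1" using e f by auto
    have "Qf u = (e * e) * qu" "Qf w = (f * f) * ((X - p)^2 - (X - p) * (Y - q) + (Y - q)^2)"
      unfolding Qf_def e f qu_def by (simp_all add: power2_eq_square algebra_simps)
    then have "Qf u + Qf w = 2 * qu + n - b"
      unfolding \<open>e * e = 1\<close> \<open>f * f = 1\<close> qu_def nXY b_def by (simp add: power2_eq_square algebra_simps)
    then show ?thesis using qb by (simp add: n_def)
  qed
  ultimately show thesis using parentI that by blast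
qed

lemma finite_Qf_le: "finite {x. Qf x \<le> n}"
proof -
  have inj: "inj pq"
  proof
    fix x y assume "pq x = pq y"
    then have "dt x y = 0" by (simp add: dt_def pnum_def pden_def)
    then show "x = y" by simp
  qed
  have "pq ` {x. Qf x \<le> n} \<subseteq> {- 2 * n..2 * n} \<times> {- 2 * n..2 * n}"
  proof clarify
    fix x p q assume x: "Qf x \<le> n" and pq: "(p, q) = pq x"
    have "2 * Qf x = p^2 + q^2 + (p - q)^2"
      unfolding Qf_def pnum_def pden_def pq[symmetric] by (simp add: power2_eq_square algebra_simps)
    moreover have "\<bar>p\<bar> \<le> p^2" "\<bar>q\<bar> \<le> q^2"
      by (metis abs_le_square_iff abs_mult_self_eq self_le_power abs_ge_zero power2_abs zero_less_numeral
          int_one_le_iff_zero_less le_less power_eq_0_iff abs_eq_0 zero_power2)+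
    ultimately have "\<bar>p\<bar> \<le> 2 * n" "\<bar>q\<bar> \<le> 2 * n"
      using x zero_le_power2[of p] zero_le_power2[of q] zero_le_power2[of "p - q"] by linarith+
    then show "p \<in> {- 2 * n..2 * n} \<and> q \<in> {- 2 * n..2 * n}" by auto
  qed
  then have "finite (pq ` {x. Qf x \<le> n})" by (rule finite_subset) simp
  then show ?thesis using inj by (simp add: finite_image_iff inj_on_subset)
qed

section \<open>The base triangle, and reaching all triangles and edges from it\<close>

lemma Qf_le_1_iff: "Qf x \<le> 1 \<longleftrightarrow> x \<in> {Some 0, Some 1, None}"
proof
  assume Q: "Qf x \<le> 1"
  have "2 * Qf x = pnum x^2 + pden x^2 + (pnum x - pden x)^2"
    unfolding Qf_def by (simp add: power2_eq_square algebra_simps)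
  then have "pnum x ^ 2 \<le> 2" "pden x ^ 2 \<le> 2" "(pnum x - pden x)^2 \<le> 2"
    using Q zero_le_power2[of "pnum x"] zero_le_power2[of "pden x"] zero_le_power2[of "pnum x - pden x"] by linarith+
  moreover have "\<bar>i\<bar> \<le> 1" if "i^2 \<le> 2" for i :: int
    using that power_mono[of 2 "\<bar>i\<bar>" 2] by fastforce
  ultimately have *: "\<bar>pnum x\<bar> \<le> 1" "\<bar>pden x\<bar> \<le> 1" "\<bar>pnum x - pden x\<bar> \<le> 1" by blast+
  show "x \<in> {Some 0, Some 1, None}"
  proof (cases x)
    case (Some r)
    obtain p q where r: "quotient_of r = (p, q)" by fastforce
    have "q > 0" using quotient_of_denom_pos[OF r] .
    then have "q = 1" "p = 0 \<or> p = 1" using * r by (auto simp: Some pnum_def pden_def pq_def)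
    then show ?thesis using quotient_of_div[OF r] by (auto simp: Some)
  qed simp
qed (auto simp: Qf_def pnum_def pden_def pq_def)

lemma base_cyc3: "cyc3 (Some 0) (Some 1) None" by (simp add: cyc3_def ext_less_def)

lemma farey_tri_iff: "farey_tri {u, v, w} \<longleftrightarrow> farey_adj u v \<and> farey_adj v w \<and> farey_adj w u"
proof
  assume "farey_tri {u, v, w}"
  then obtain a b c where T: "{u, v, w} = {a, b, c}" and adj: "farey_adj a b" "farey_adj b c" "farey_adj c a"
    unfolding farey_tri_def by blast
  have "card {u, v, w} = 3" unfolding T using adj[THEN farey_adj_neq] by auto
  then have "u \<noteq> v" "v \<noteq> w" "w \<noteq> u" by (auto simp: card_insert_if split: if_splits)
  moreover have "farey_adj x y" if "x \<in> {u, v, w}" "y \<in> {u, v, w}" "x \<noteq> y" for x y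
    using that adj farey_adj_sym unfolding T by blast
  ultimately show "farey_adj u v \<and> farey_adj v w \<and> farey_adj w u" by simp
qed (auto simp: farey_tri_def)

text \<open>The value at \<open>x\<close> is \<open>Qf u + Qf w\<close> plus or minus
  \<open>m\<close>. With the minus sign, maximality of \<open>x\<close> gives
  \<open>m \<le> Qf u\<close> and \<open>m \<le> Qf w\<close>, and the discriminant identity then
  forces \<open>Qf u = Qf w = 1\<close> and \<open>Qf x \<le> 1\<close>.\<close>

lemma farey_tri_parent_aux:
  assumes adj: "farey_adj u w" "farey_adj u x" "farey_adj w x" and le: "Qf u \<le> Qf x" "Qf w \<le> Qf x"
    and "Qf x > 1"
  shows "parent x u w \<or> parent x w u"
proof -
  have d: "\<bar>dt u w\<bar> = 1" using adj by (simp add: farey_adj_iff)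
  define m where "m = \<bar>Bf u w\<bar>"
  have disc: "m * m + 3 = 4 * (Qf u * Qf w)"
    using Bf_discriminant[of u w] abs1_sq[OF d] by (simp add: m_def power2_eq_square mult.assoc)
  have "x = third u w \<or> x = third w u"
    using third_eqI[of u w x] third_eqI[of w u x] cyc3_total[of u x w] adj farey_adj_neq
    by (metis farey_adj_sym)
  then have "Qf x = Qf u + Qf w + m \<or> Qf x = Qf u + Qf w - m"
    using third_props(4)[of u w] third_props(4)[of w u] adj(1) d
    by (auto simp: farey_adj_sym[of w u] dt_skew[of w u] Bf_sym[of w u] m_def abs_if split: if_splits)
  then have "Qf u + Qf w < Qf x"
  proof
    assume "Qf x = Qf u + Qf w + m"
    moreover have "m \<noteq> 0" using disc by (auto, presburger)
    ultimately show ?thesis by (simp add: m_def)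
  next
    assume m: "Qf x = Qf u + Qf w - m"
    then have "m \<le> Qf u" "m \<le> Qf w" using le by auto
    then have "m * m \<le> Qf u * Qf w" using Qf_pos[of u] by (intro mult_mono) (auto simp: m_def)
    then have "Qf u * Qf w \<le> 1" using disc by simp
    then have "Qf u = 1" "Qf w = 1"
      using Qf_pos[of u] Qf_pos[of w] mult_mono[of 1 "Qf u" 2 "Qf w"] mult_mono[of 2 "Qf u" 1 "Qf w"] by force+
    moreover from this have "m \<noteq> 0" using disc by auto
    ultimately show ?thesis using m \<open>Qf x > 1\<close> by (simp add: m_def)
  qed
  then show ?thesis by (rule parentI[OF adj])
qed

text \<open>The vertex of largest value is attached across the opposite edge, so the triple ratios
  prescribed during attachment reach every triangle outside the base.\<close>

lemma farey_tri_cases: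
  assumes "farey_tri T"
  obtains (base) "T = {Some 0, Some 1, None}" | (parent) x u w where "T = {u, w, x}" "parent x u w"
proof -
  obtain a b c where T: "T = {a, b, c}" and adj: "farey_adj a b" "farey_adj b c" "farey_adj c a"
    using assms unfolding farey_tri_def by blast
  have ex: thesis if "T = {u, w, x}" "farey_adj u w" "farey_adj u x" "farey_adj w x"
    "Qf u \<le> Qf x" "Qf w \<le> Qf x" for u w x
  proof (cases "Qf x > 1")
    case True
    then show thesis using farey_tri_parent_aux[OF that(2-6)] parent[of u w x] parent[of w u x] that(1)
      by (auto simp: insert_commute)
  next
    case False
    have "T \<subseteq> {Some 0, Some 1, None}"
    proof
      fix y assume "y \<in> T"
      then have "Qf y \<le> 1" using that False by auto
      then show "y \<in> {Some 0, Some 1, None}" by (simp only: Qf_le_1_iff)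
    qed
    moreover have "card T = 3" unfolding that(1) using that(2-4)[THEN farey_adj_neq] by auto
    ultimately have "T = {Some 0, Some 1, None}"
      by (intro card_subset_eq) auto
    then show thesis by (rule base)
  qed
  consider "Qf a \<le> Qf c" "Qf b \<le> Qf c" | "Qf a \<le> Qf b" "Qf c \<le> Qf b" | "Qf b \<le> Qf a" "Qf c \<le> Qf a"
    by linarith
  moreover have "farey_adj b a" "farey_adj c b" "farey_adj a c"
    using adj by (simp_all add: farey_adj_sym)
  moreover have "T = {a, c, b}" "T = {b, c, a}" unfolding T by blast+
  ultimately show thesis using ex T adj by metis
qed

text \<open>\<open>Bf u w\<close> is nonzero modulo 4, so one of the two third vertices has value
  above \<open>Qf u + Qf w\<close>. Attaching it prescribes both coordinates of the edge.\<close>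

lemma edge_parent:
  assumes "farey_adj u w"
  shows "parent (third w u) u w \<or> parent (third u w) w u"
proof -
  have d: "\<bar>dt u w\<bar> = 1" using assms by (simp add: farey_adj_iff)
  have "Bf u w * Bf u w + 3 = 4 * (Qf u * Qf w)"
    using Bf_discriminant[of u w] abs1_sq[OF d] by (simp add: power2_eq_square mult.assoc)
  then have "Bf u w \<noteq> 0" by (auto, presburger)
  then have "dt u w * Bf u w \<noteq> 0" using d by auto
  then have "Qf u + Qf w < Qf (third u w) \<or> Qf u + Qf w < Qf (third w u)"
    using third_props(4)[OF assms] Qf_third_sum[OF assms] by linarith
  then show ?thesis using assms by (auto simp: parent_def farey_adj_sym)
qed

subsection \<open>Flags and projective maps\<close>

lemma rep_unique: "rep F a n \<Longrightarrow> rep G a n \<Longrightarrow> F = G"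
  by (simp add: rep_def)

lemma rep_scale_unique:
  assumes "rep F a n" "rep F b m"
  obtains c d where "c \<noteq> 0" "d \<noteq> 0" "b = c *\<^sub>R a" "m = d *\<^sub>R n"
proof -
  have e: "span {a} = span {b}" "{x. n \<bullet> x = 0} = {x. m \<bullet> x = 0}" and nz: "b \<noteq> 0" "n \<noteq> 0" "m \<noteq> 0"
    using assms unfolding rep_def by simp_all
  have "b \<in> span {a}" unfolding e(1) by (simp add: span_base)
  then obtain c where "b = c *\<^sub>R a" unfolding span_singleton by (rule rangeE)
  moreover from this have "c \<noteq> 0" using nz by (rule_tac notI) simp
  moreover obtain d where "d \<noteq> 0" "m = d *\<^sub>R n"
    using normal_unique[OF nz(2,3)] e(2) by blast
  ultimately show thesis using that by blast
qed

lemma matrix_inv_mult: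
  assumes "invertible (g :: real^3^3)"
  shows "g ** matrix_inv g = mat 1" "matrix_inv g ** g = mat 1"
proof -
  have "g ** matrix_inv g = mat 1 \<and> matrix_inv g ** g = mat 1"
    unfolding matrix_inv_def by (rule someI_ex) (use assms in \<open>simp add: invertible_def\<close>)
  then show "g ** matrix_inv g = mat 1" "matrix_inv g ** g = mat 1" by blast+
qed

text \<open>Covectors move by the inverse transpose, which keeps their pairings with moved
  vectors.\<close>

definition contra :: "real^3^3 \<Rightarrow> real^3 \<Rightarrow> real^3" where
  "contra g n = transpose (matrix_inv g) *v n"

lemma contra_inner: "invertible g \<Longrightarrow> contra g n \<bullet> (g *v x) = n \<bullet> x"
  by (simp add: contra_def dot_lmul_matrix matrix_vector_mul_assoc matrix_inv_mult)

lemma det3_matrix: "det3 (g *v x) (g *v y) (g *v z) = det g * det3 x y z"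
proof -
  have "(vector [g *v x, g *v y, g *v z] :: real^3^3) = vector [x, y, z] ** transpose g"
    by (simp add: vec_eq_iff forall_3 matrix_matrix_mult_def matrix_vector_mult_def transpose_def
        vector_3 sum_3 mult.commute)
  then show ?thesis by (simp add: det3_def det_mul det_transpose mult.commute)
qed

lemma rep_act:
  assumes g: "invertible g" and r: "rep F a n"
  shows "rep (act g F) (g *v a) (contra g n)"
proof -
  have inj: "g *v x = 0 \<longleftrightarrow> x = 0" for x
    using g by (metis invertible_def matrix_left_invertible_ker matrix_vector_mult_0_right)
  have surj: "\<exists>x. y = g *v x" for y
    using g by (metis matrix_inv_mult(1) matrix_vector_mul_assoc matrix_vector_mul_lid)
  have n: "a \<noteq> 0" "n \<noteq> 0" "n \<bullet> a = 0" "F = (span {a}, {x. n \<bullet> x = 0})" using r by (simp_all add: rep_def)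
  have "contra g n \<noteq> 0"
    using contra_inner[OF g, of n n] n(2) by (metis inner_eq_zero_iff inner_zero_left)
  moreover have "(\<lambda>x. g *v x) ` span {a} = span {g *v a}"
    using linear_span_image[OF matrix_vector_mul_linear, of g "{a}"] by simp
  moreover have "(\<lambda>x. g *v x) ` {x. n \<bullet> x = 0} = {x. contra g n \<bullet> x = 0}"
  proof (intro set_eqI iffI)
    fix y assume "y \<in> (\<lambda>x. g *v x) ` {x. n \<bullet> x = 0}"
    then show "y \<in> {x. contra g n \<bullet> x = 0}" using contra_inner[OF g] by auto
  next
    fix y assume y: "y \<in> {x. contra g n \<bullet> x = 0}"
    obtain x where x: "y = g *v x" using surj by blast
    have "n \<bullet> x = 0" using y unfolding x by (simp add: contra_inner[OF g])
    then show "y \<in> (\<lambda>x. g *v x) ` {x. n \<bullet> x = 0}" using x by blast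
  qed
  ultimately show ?thesis
    unfolding rep_def act_def n(4) by (simp add: n inj contra_inner[OF g])
qed

text \<open>Since \<open>a\<close>, \<open>p\<close>, \<open>q\<close> form a basis, a covector
  vanishing on \<open>a\<close> is known up to scale from the ratio of its values at
  \<open>p\<close> and \<open>q\<close>. The hypothesis \<open>eq\<close> is this proportion between
  the two normals.\<close>

lemma act_eqI:
  assumes g: "invertible g" and r: "rep F a n" "rep F' a' n'"
    and a: "g *v a = c *\<^sub>R a'" "c \<noteq> 0" and d: "det3 a p q \<noteq> 0" and p: "n \<bullet> p \<noteq> 0" "n' \<bullet> (g *v p) \<noteq> 0"
    and eq: "(n' \<bullet> (g *v p)) * (n \<bullet> q) = (n' \<bullet> (g *v q)) * (n \<bullet> p)"
  shows "act g F = F'"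
proof -
  define t where "t = (n' \<bullet> (g *v p)) / (n \<bullet> p)"
  have t: "t \<noteq> 0" using p by (simp add: t_def)
  have z: "n \<bullet> a = 0" "n' \<bullet> a' = 0" using r by (simp_all add: rep_def)
  define z where "z = n' - t *\<^sub>R contra g n"
  have "z \<bullet> (g *v a) = 0" "z \<bullet> (g *v p) = 0" "z \<bullet> (g *v q) = 0"
    unfolding z_def inner_diff_left inner_scaleR_left contra_inner[OF g] using p eq z
    by (simp_all add: a(1) t_def field_simps)
  moreover have "det3 (g *v a) (g *v p) (g *v q) \<noteq> 0"
    using d g by (simp add: det3_matrix invertible_det_nz)
  ultimately have "z = 0" using det3_eq_0 by blast
  then have "n' = t *\<^sub>R contra g n" by (simp add: z_def)
  then have "rep (act g F) (c *\<^sub>R a') n'"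
    using rep_scale[OF rep_act[OF g r(1)], of 1 t] t by (simp add: a(1))
  then show ?thesis using rep_scale[OF r(2) a(2), of 1] by (intro rep_unique) simp_all
qed

lemma matrix_on_basis:
  assumes d: "det3 u v w \<noteq> 0" "det3 u' v' w' \<noteq> 0"
  obtains g :: "real^3^3" where "invertible g" "g *v u = u'" "g *v v = v'" "g *v w = w'"
proof -
  define f where "f x = (1 / det3 u v w) *\<^sub>R (det3 x v w *\<^sub>R u' + det3 u x w *\<^sub>R v' + det3 u v x *\<^sub>R w')" for x
  have "linear f"
    by (rule linearI) (simp_all add: f_def det3_linear scaleR_add_left scaleR_add_right algebra_simps)
  then have w: "matrix f *v x = f x" for x by (simp add: matrix_vector_mul(2)[THEN fun_cong])
  have f: "f u = u'" "f v = v'" "f w = w'" using d by (simp_all add: f_def)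
  have "det (matrix f) * det3 u v w = det3 u' v' w'"
    using det3_matrix[of "matrix f" u v w] by (simp add: w f)
  then have "invertible (matrix f)" using d by (auto simp: invertible_det_nz)
  then show thesis using that[of "matrix f"] w f by simp
qed

section \<open>Rigidity of an attached flag and of the base triple\<close>

definition edge_ratio :: "flag \<Rightarrow> flag \<Rightarrow> flag \<Rightarrow> flag \<Rightarrow> real" where
  "edge_ratio Fu Fv Fw Fx = cross_ratio_lines (fst Fu) (snd Fu) (join (fst Fu) (fst Fv))
      (join (fst Fu) (fst Fw)) (join (fst Fu) (fst Fx))"

lemma edge_ratio_rep:
  assumes "rep Fu u ku" "rep Fv v kv" "rep Fw w kw" "rep Fx x kx"
    and "det3 u v w \<noteq> 0" "det3 u w x \<noteq> 0"
  shows "edge_ratio Fu Fv Fw Fx = ((ku \<bullet> v) * det3 u w x) / ((ku \<bullet> x) * det3 u v w)"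
  unfolding edge_ratio_def by (rule cross_ratio_rep[OF assms])

text \<open>Once \<open>y\<close> and \<open>x\<close> are scaled to equal determinant with
  \<open>u\<close> and \<open>w\<close>, the edge coordinates say that \<open>ku\<close> and
  \<open>kw\<close> kill their difference. It lies in the span of \<open>u\<close> and
  \<open>w\<close>, where these two covectors are independent, so it is 0. The triple ratio then
  fixes the normal on the basis \<open>u\<close>, \<open>w\<close>, \<open>x\<close>.\<close>

lemma third_flag_unique:
  assumes r: "rep Fu u ku" "rep Fv v kv" "rep Fw w kw" "rep Fx x kx" "rep Fy y ky"
    and d: "det3 u v w \<noteq> 0" "det3 u w x \<noteq> 0" "det3 u w y \<noteq> 0"
    and k: "ku \<bullet> v \<noteq> 0" "ku \<bullet> w \<noteq> 0" "kw \<bullet> u \<noteq> 0" "kw \<bullet> v \<noteq> 0" 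
       "ku \<bullet> x \<noteq> 0" "kw \<bullet> x \<noteq> 0" "kx \<bullet> u \<noteq> 0" "kx \<bullet> w \<noteq> 0"
       "ku \<bullet> y \<noteq> 0" "kw \<bullet> y \<noteq> 0" "ky \<bullet> u \<noteq> 0" "ky \<bullet> w \<noteq> 0"
    and e: "edge_ratio Fu Fv Fw Fx = edge_ratio Fu Fv Fw Fy"
      "edge_ratio Fw Fx Fu Fv = edge_ratio Fw Fy Fu Fv"
      "triple_ratio Fu Fw Fx = triple_ratio Fu Fw Fy"
  shows "Fx = Fy"
proof -
  have d': "det3 w u v \<noteq> 0" "det3 w x u \<noteq> 0" "det3 w y u \<noteq> 0" "det3 w x u = det3 u w x" "det3 w y u = det3 u w y"
    using d by (simp_all add: det3_rotate)
  have u: "ku \<bullet> u = 0" and w: "kw \<bullet> w = 0" and x: "kx \<bullet> x = 0" and y: "ky \<bullet> y = 0"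
    using r by (simp_all add: rep_def)
  define c where "c = det3 u w y / det3 u w x"
  have c: "c \<noteq> 0" using d by (simp add: c_def)
  define z where "z = y - c *\<^sub>R x"
  have "ku \<bullet> z = 0"
    using e(1) k d unfolding edge_ratio_rep[OF r(1-4) d(1,2)] edge_ratio_rep[OF r(1-3,5) d(1,3)]
    by (simp add: z_def c_def inner_diff_right field_simps)
  moreover have "kw \<bullet> z = 0"
    using e(2) k d d'(1) unfolding edge_ratio_rep[OF r(3,4,1,2) d'(2,1)] edge_ratio_rep[OF r(3,5,1,2) d'(3,1)] d'(4,5)
    by (simp add: z_def c_def inner_diff_right field_simps)
  moreover have "det3 u z w = 0"
    using d by (simp add: z_def c_def det3_linear det3_swap(2)[of u w])
  ultimately have "ku \<bullet> (det3 u v w *\<^sub>R z) = det3 u v z * (ku \<bullet> w)" "kw \<bullet> (det3 u v w *\<^sub>R z) = det3 z v w * (kw \<bullet> u)"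
     and z: "ku \<bullet> z = 0" "kw \<bullet> z = 0" "det3 u z w = 0"
    unfolding cramer3[of u v w z] by (simp_all add: inner_add_right u w)
  then have "det3 u v z = 0" "det3 z v w = 0" using k by auto
  then have "z = 0" using cramer3[of u v w z] d(1) z(3) by simp
  then have yx: "y = c *\<^sub>R x" by (simp add: z_def)
  define t where "t = (ky \<bullet> u) / (kx \<bullet> u)"
  have t: "t \<noteq> 0" using k by (simp add: t_def)
  have "(kx \<bullet> u) * (ky \<bullet> w) = (ky \<bullet> u) * (kx \<bullet> w)"
    using e(3) k c unfolding triple_ratio_rep[OF r(1,3,4)] triple_ratio_rep[OF r(1,3,5)]
    by (simp add: yx field_simps)
  then have "(ky - t *\<^sub>R kx) \<bullet> u = 0" "(ky - t *\<^sub>R kx) \<bullet> w = 0" "(ky - t *\<^sub>R kx) \<bullet> x = 0"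
    using k c x y by (simp_all add: t_def inner_diff_left yx field_simps)
  then have "ky - t *\<^sub>R kx = 0" using det3_eq_0 d(2) by blast
  then have "ky = t *\<^sub>R kx" by simp
  then show "Fx = Fy" using rep_scale[OF r(4) c t] r(5) yx rep_unique by simp
qed

lemma triples_equivalent:
  assumes r: "rep Fu u ku" "rep Fv v kv" "rep Fw w kw" "rep Gu u' lu" "rep Gv v' lv" "rep Gw w' lw"
    and d: "det3 u v w \<noteq> 0" "det3 u' v' w' \<noteq> 0"
    and k: "ku \<bullet> v \<noteq> 0" "ku \<bullet> w \<noteq> 0" "kv \<bullet> u \<noteq> 0" "kv \<bullet> w \<noteq> 0" "kw \<bullet> u \<noteq> 0" "kw \<bullet> v \<noteq> 0"
      "lu \<bullet> v' \<noteq> 0" "lu \<bullet> w' \<noteq> 0" "lv \<bullet> u' \<noteq> 0" "lv \<bullet> w' \<noteq> 0" "lw \<bullet> u' \<noteq> 0" "lw \<bullet> v' \<noteq> 0"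
    and e: "triple_ratio Fu Fv Fw = triple_ratio Gu Gv Gw"
  obtains g where "invertible g" "act g Fu = Gu" "act g Fv = Gv" "act g Fw = Gw"
proof -
  \<comment> \<open>The factor \<open>b\<close> is what carrying the line of \<open>w\<close>
    requires, and \<open>c\<close> does the same for the line of \<open>v\<close>. The condition
    left over, for the line of \<open>u\<close>, is equality of triple ratios.\<close>
  define b where "b = (kw \<bullet> v) * (lw \<bullet> u') / ((kw \<bullet> u) * (lw \<bullet> v'))"
  define c where "c = (kv \<bullet> w) * (lv \<bullet> u') / ((kv \<bullet> u) * (lv \<bullet> w'))"
  have bc: "b \<noteq> 0" "c \<noteq> 0" using k by (simp_all add: b_def c_def)
  have "det3 u' (b *\<^sub>R v') (c *\<^sub>R w') \<noteq> 0" using d bc by (simp add: det3_linear)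
  then obtain g where g: "invertible g" "g *v u = u'" "g *v v = b *\<^sub>R v'" "g *v w = c *\<^sub>R w'"
    using matrix_on_basis[OF d(1)] by blast
  have e': "(lu \<bullet> v') * b * (ku \<bullet> w) = (lu \<bullet> w') * c * (ku \<bullet> v)"
    using e k unfolding triple_ratio_rep[OF r(1-3)] triple_ratio_rep[OF r(4-6)] b_def c_def
    by (simp add: field_simps)
  have d': "det3 v u w \<noteq> 0" "det3 w u v \<noteq> 0" using d by (simp_all add: det3_swap(1)[of v] det3_rotate)
  have "act g Fu = Gu"
    by (rule act_eqI[OF g(1) r(1,4) _ _ d(1), where c = 1])
      (use g k bc e' in \<open>simp_all add: mult_ac\<close>)
  moreover have "act g Fv = Gv"
    by (rule act_eqI[OF g(1) r(2,5) g(3) bc(1) d'(1)])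
      (use g k in \<open>simp_all add: c_def field_simps\<close>)
  moreover have "act g Fw = Gw"
    by (rule act_eqI[OF g(1) r(3,6) g(4) bc(2) d'(2)])
      (use g k in \<open>simp_all add: b_def field_simps\<close>)
  ultimately show thesis using that g(1) by blast
qed

subsection \<open>Coordinates of a positive map\<close>

lemma triple_ratio_rotate: "triple_ratio Fv Fw Fu = triple_ratio Fu Fv Fw"
  by (simp add: triple_ratio_def mult_ac)

text \<open>Oriented enumerations of a triangle differ by rotations, under which the triple ratio is
  constant, so the choice is harmless.\<close>

lemma tri_val_eq:
  assumes "cyc3 u v w"
  shows "tri_val \<beta> {u, v, w} = triple_ratio (\<beta> u) (\<beta> v) (\<beta> w)"
  unfolding tri_val_def
proof (rule some_equality)
  show "\<exists>a b c. {u, v, w} = {a, b, c} \<and> cyc3 a b c \<and>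
      triple_ratio (\<beta> u) (\<beta> v) (\<beta> w) = triple_ratio (\<beta> a) (\<beta> b) (\<beta> c)"
    using assms by blast
next
  fix r assume "\<exists>a b c. {u, v, w} = {a, b, c} \<and> cyc3 a b c \<and> r = triple_ratio (\<beta> a) (\<beta> b) (\<beta> c)"
  then obtain a b c where abc: "{u, v, w} = {a, b, c}" "cyc3 a b c" "r = triple_ratio (\<beta> a) (\<beta> b) (\<beta> c)"
    by blast
  have n: "a \<noteq> b" "b \<noteq> c" "c \<noteq> a" using cyc3_neq[OF abc(2)] by auto
  have "a \<in> {u, v, w}" "b \<in> {u, v, w}" "c \<in> {u, v, w}" unfolding abc(1) by simp_all
  moreover have "\<not> cyc3 w v u" "\<not> cyc3 v u w" "\<not> cyc3 u w v"
    using cyc3_asym[OF assms] cyc3_rotate by blast+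
  ultimately have "(a, b, c) = (u, v, w) \<or> (a, b, c) = (v, w, u) \<or> (a, b, c) = (w, u, v)"
    using n abc(2) by auto
  then show "r = triple_ratio (\<beta> u) (\<beta> v) (\<beta> w)"
    using abc(3) triple_ratio_rotate by (metis prod.inject)
qed

lemma edge_val_eq:
  assumes uw: "farey_adj u w"
  shows "edge_val \<beta> u w = edge_ratio (\<beta> u) (\<beta> (third u w)) (\<beta> w) (\<beta> (third w u))"
  unfolding edge_val_def edge_ratio_def[symmetric]
proof (rule some_equality)
  show "\<exists>v x. farey_tri {u, v, w} \<and> farey_tri {u, w, x} \<and> cyc4 u v w x \<and>
     edge_ratio (\<beta> u) (\<beta> (third u w)) (\<beta> w) (\<beta> (third w u)) = edge_ratio (\<beta> u) (\<beta> v) (\<beta> w) (\<beta> x)"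
    using third_cyc4[OF uw] third_props(1,2)[OF uw] third_props(1,2)[of w u] uw
    unfolding farey_tri_iff by (metis farey_adj_sym)
next
  fix r assume "\<exists>v x. farey_tri {u, v, w} \<and> farey_tri {u, w, x} \<and> cyc4 u v w x \<and>
     r = edge_ratio (\<beta> u) (\<beta> v) (\<beta> w) (\<beta> x)"
  then obtain v x where vx: "farey_tri {u, v, w}" "farey_tri {u, w, x}" "cyc4 u v w x"
     "r = edge_ratio (\<beta> u) (\<beta> v) (\<beta> w) (\<beta> x)" by blast
  have "third u w = v" "third w u = x"
    using vx(1,2) cyc4_imp_cyc3[OF vx(3)] uw unfolding farey_tri_iff
    by (metis farey_adj_sym third_eqI)+
  then show "r = edge_ratio (\<beta> u) (\<beta> (third u w)) (\<beta> w) (\<beta> (third w u))" using vx(4) by simp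
qed

text \<open>The representatives belong to this quadruple alone; nothing is claimed about their
  agreement between quadruples.\<close>

lemma positive_map_reps:
  assumes "positive_map \<beta>" "cyc4 x1 x2 x3 x4"
  obtains a1 n1 a2 n2 a3 n3 a4 n4 where
    "rep (\<beta> x1) a1 n1" "rep (\<beta> x2) a2 n2" "rep (\<beta> x3) a3 n3" "rep (\<beta> x4) a4 n4"
    "n1 \<bullet> a2 > 0" "n1 \<bullet> a3 > 0" "n1 \<bullet> a4 > 0" "n2 \<bullet> a1 > 0" "n2 \<bullet> a3 > 0" "n2 \<bullet> a4 > 0"
    "n3 \<bullet> a1 > 0" "n3 \<bullet> a2 > 0" "n3 \<bullet> a4 > 0" "n4 \<bullet> a1 > 0" "n4 \<bullet> a2 > 0" "n4 \<bullet> a3 > 0"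
    "det3 a1 a2 a3 > 0" "det3 a2 a3 a4 > 0" "det3 a3 a4 a1 > 0" "det3 a4 a1 a2 > 0"
  using assms by (auto simp: positive_map_def intro: positive_quadE[of "\<beta> x1" "\<beta> x2" "\<beta> x3" "\<beta> x4"])

lemma edge_val_pos:
  assumes b: "positive_map \<beta>" and uw: "farey_adj u w"
  shows "edge_val \<beta> u w > 0"
proof (rule positive_map_reps[OF b third_cyc4[OF uw]], goal_cases)
  case (1 a1 n1 a2 n2 a3 n3 a4 n4)
  have "det3 a1 a2 a3 \<noteq> 0" "det3 a1 a3 a4 \<noteq> 0" "det3 a1 a3 a4 > 0"
    using 1(17,19) by (simp_all add: det3_rotate)
  then show ?case
    unfolding edge_val_eq[OF uw] edge_ratio_rep[OF 1(1-4) \<open>det3 a1 a2 a3 \<noteq> 0\<close> \<open>det3 a1 a3 a4 \<noteq> 0\<close>]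
    using 1(5,7,17) by simp
qed

text \<open>Positivity concerns four flags. In this form a triangle is completed to a cyclic
  quadruple by the third vertex across the edge \<open>uw\<close>.\<close>

lemma farey_tri_oriented:
  assumes "farey_tri T"
  obtains u v w where "T = {u, v, w}" "cyc3 u v w" "farey_adj u w" "third u w = v"
proof -
  obtain a b c where T: "T = {a, b, c}" and adj: "farey_adj a b" "farey_adj b c" "farey_adj c a"
    using assms unfolding farey_tri_def by blast
  have "cyc3 a b c \<or> cyc3 c b a" using cyc3_total adj[THEN farey_adj_neq] by blast
  then show thesis
  proof
    assume c: "cyc3 a b c"
    have "third a c = b" using third_eqI[of a c b] c adj farey_adj_sym by blast
    then show thesis using that[of a b c] T c adj farey_adj_sym by blast
  next
    assume c: "cyc3 c b a"
    have "third c a = b" using third_eqI[of c a b] c adj farey_adj_sym by blast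
    then show thesis using that[of c b a] T c adj by auto
  qed
qed

lemma tri_val_pos:
  assumes b: "positive_map \<beta>" and T: "farey_tri T"
  shows "tri_val \<beta> T > 0"
proof -
  obtain u v w where u: "T = {u, v, w}" "cyc3 u v w" "farey_adj u w" "third u w = v"
    using farey_tri_oriented[OF T] by blast
  show ?thesis
  proof (rule positive_map_reps[OF b third_cyc4[OF u(3)]], unfold u(4), goal_cases)
    case (1 a1 n1 a2 n2 a3 n3 a4 n4)
    then show ?case unfolding u(1) tri_val_eq[OF u(2)] triple_ratio_rep[OF 1(1-3)] by simp
  qed
qed

section \<open>The coordinate map: positivity and projective invariance\<close>

lemma phi_map_in: "positive_map \<beta> \<Longrightarrow> phi_map \<beta> \<in> I3 \<rightarrow>\<^sub>E {0<..}"
  by (auto simp: phi_map_def I3_def edge_val_pos tri_val_pos)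

lemma phi_map_TriI: "farey_tri T \<Longrightarrow> phi_map \<beta> (TriI T) = tri_val \<beta> T"
  by (auto simp: phi_map_def I3_def)

lemma phi_map_EdgeI: "farey_adj u w \<Longrightarrow> phi_map \<beta> (EdgeI u w) = edge_val \<beta> u w"
  by (auto simp: phi_map_def I3_def)

lemma phi_map_eqI:
  assumes "\<And>T. farey_tri T \<Longrightarrow> tri_val \<beta> T = c (TriI T)"
    "\<And>u w. farey_adj u w \<Longrightarrow> edge_val \<beta> u w = c (EdgeI u w)" "c \<in> extensional I3"
  shows "phi_map \<beta> = c"
proof (rule extensionalityI)
  show "phi_map \<beta> \<in> extensional I3" by (simp add: phi_map_def)
  fix i assume "i \<in> I3"
  then show "phi_map \<beta> i = c i"
    using assms(1,2) unfolding I3_def by (auto simp: phi_map_TriI phi_map_EdgeI)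
qed (rule assms(3))

lemma phi_map_act:
  assumes b: "positive_map \<beta>" and g: "invertible g" and b': "\<And>y. \<beta>' y = act g (\<beta> y)"
  shows "phi_map \<beta>' = phi_map \<beta>"
proof (rule phi_map_eqI)
  fix T assume T: "farey_tri T"
  obtain u v w where u: "T = {u, v, w}" "cyc3 u v w" "farey_adj u w" "third u w = v"
    using farey_tri_oriented[OF T] by blast
  show "tri_val \<beta>' T = phi_map \<beta> (TriI T)"
    unfolding phi_map_TriI[OF T]
  proof (rule positive_map_reps[OF b third_cyc4[OF u(3)]], unfold u(4), goal_cases)
    case (1 a1 n1 a2 n2 a3 n3 a4 n4)
    note r = 1(1-3)[THEN rep_act[OF g], folded b']
    show ?case unfolding u(1) tri_val_eq[OF u(2)] triple_ratio_rep[OF 1(1-3)] triple_ratio_rep[OF r]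
        contra_inner[OF g] ..
  qed
next
  have dg: "det g \<noteq> 0" using g by (simp add: invertible_det_nz)
  fix u w assume uw: "farey_adj u w"
  show "edge_val \<beta>' u w = phi_map \<beta> (EdgeI u w)"
    unfolding phi_map_EdgeI[OF uw]
  proof (rule positive_map_reps[OF b third_cyc4[OF uw]], goal_cases)
    case (1 a1 n1 a2 n2 a3 n3 a4 n4)
    note r = 1(1-4)[THEN rep_act[OF g], folded b']
    have d: "det3 a1 a2 a3 \<noteq> 0" "det3 a1 a3 a4 \<noteq> 0"
      using 1(17,19) by (simp_all add: det3_rotate)
    then have d': "det3 (g *v a1) (g *v a2) (g *v a3) \<noteq> 0" "det3 (g *v a1) (g *v a3) (g *v a4) \<noteq> 0"
      using dg by (simp_all add: det3_matrix)
    show ?case unfolding edge_val_eq[OF uw] edge_ratio_rep[OF 1(1-4) d] edge_ratio_rep[OF r d']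
      contra_inner[OF g] det3_matrix using dg by simp
  qed
qed (simp add: phi_map_def)

subsection \<open>Injectivity\<close>

lemma base_edge: "farey_adj (Some 0) None" "third (Some 0) None = Some 1"
proof -
  show "farey_adj (Some 0) None" by (simp add: farey_adj_def pq_def)
  then show "third (Some 0) None = Some 1"
    by (rule third_eqI) (simp_all add: farey_adj_def pq_def base_cyc3)
qed

lemma base_tri: "farey_tri {Some 0, Some 1, None}"
  by (simp add: farey_tri_iff farey_adj_def pq_def)

lemma parent_tri: "parent x u w \<Longrightarrow> farey_tri {u, w, x}"
  using parentD[of x u w] by (simp add: farey_tri_iff farey_adj_sym)

lemma parent_cyc3: "parent x u w \<Longrightarrow> cyc3 u w x"
  using parentD(8)[of x u w] cyc3_rotate by blast

text \<open>One projective map makes the two maps agree on the base triangle; invariance keeps all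
  coordinates equal, and \<open>third_flag_unique\<close> spreads the agreement by induction on
  \<open>Qf\<close>.\<close>

lemma equal_coordinates_equivalent:
  assumes b: "positive_map \<beta>" and b': "positive_map \<beta>'" and eq: "phi_map \<beta> = phi_map \<beta>'"
  obtains g where "invertible g" "\<And>y. \<beta>' y = act g (\<beta> y)"
proof -
  have tri_eq: "tri_val \<beta> T = tri_val \<beta>' T" if "farey_tri T" for T
    using phi_map_TriI[OF that, of \<beta>] phi_map_TriI[OF that, of \<beta>'] eq by simp
  have t: "triple_ratio (\<beta> (Some 0)) (\<beta> (Some 1)) (\<beta> None) = triple_ratio (\<beta>' (Some 0)) (\<beta>' (Some 1)) (\<beta>' None)"
    using tri_eq[OF base_tri] unfolding tri_val_eq[OF base_cyc3] .
  note q = third_cyc4[OF base_edge(1), unfolded base_edge(2)]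
  obtain g where g: "invertible g" "act g (\<beta> (Some 0)) = \<beta>' (Some 0)"
    "act g (\<beta> (Some 1)) = \<beta>' (Some 1)" "act g (\<beta> None) = \<beta>' None"
  proof (rule positive_map_reps[OF b q], rule positive_map_reps[OF b' q], goal_cases)
    case (1 a1 n1 a2 n2 a3 n3 a4 n4 b1 m1 b2 m2 b3 m3 b4 m4)
    show ?case
      by (rule triples_equivalent[OF 1(2-4) 1(22-24) _ _ _ _ _ _ _ _ _ _ _ _ _ _ t])
        (use 1 in \<open>simp_all\<close>)
  qed
  define \<beta>2 where "\<beta>2 y = act g (\<beta> y)" for y
  have eq2: "phi_map \<beta>2 = phi_map \<beta>'"
    using phi_map_act[OF b g(1), of \<beta>2] eq by (simp add: \<beta>2_def)
  have tri2: "tri_val \<beta>2 T = tri_val \<beta>' T" if "farey_tri T" for T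
    using phi_map_TriI[OF that, of \<beta>2] phi_map_TriI[OF that, of \<beta>'] eq2 by simp
  have edge2: "edge_val \<beta>2 u w = edge_val \<beta>' u w" if "farey_adj u w" for u w
    using phi_map_EdgeI[OF that, of \<beta>2] phi_map_EdgeI[OF that, of \<beta>'] eq2 by simp
  have "\<beta>2 y = \<beta>' y" for y
  proof (induction "nat (Qf y)" arbitrary: y rule: less_induct)
    case less
    show ?case
    proof (cases "Qf y \<le> 1")
      case True
      then have "y = Some 0 \<or> y = Some 1 \<or> y = None" unfolding Qf_le_1_iff by simp
      then show ?thesis using g by (auto simp: \<beta>2_def)
    next
      case False
      then obtain u w where p: "parent y u w" using parent_exists[of y] by auto
      note p' = parentD[OF p]
      define v where "v = third u w"
      note uw = p'(1)
      have wu: "farey_adj w u" using uw by (simp add: farey_adj_sym)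
      have IH: "\<beta>2 u = \<beta>' u" "\<beta>2 w = \<beta>' w" "\<beta>2 v = \<beta>' v"
        using less p'(3-5) Qf_pos[of u] Qf_pos[of v] Qf_pos[of w] by (simp_all add: v_def)
      have e: "edge_ratio (\<beta>' u) (\<beta>' v) (\<beta>' w) (\<beta>2 y) = edge_ratio (\<beta>' u) (\<beta>' v) (\<beta>' w) (\<beta>' y)"
        using edge2[OF uw] unfolding edge_val_eq[OF uw] p'(2) v_def[symmetric] IH .
      have e': "edge_ratio (\<beta>' w) (\<beta>2 y) (\<beta>' u) (\<beta>' v) = edge_ratio (\<beta>' w) (\<beta>' y) (\<beta>' u) (\<beta>' v)"
        using edge2[OF wu] unfolding edge_val_eq[OF wu] p'(2) v_def[symmetric] IH .
      have t': "triple_ratio (\<beta>' u) (\<beta>' w) (\<beta>2 y) = triple_ratio (\<beta>' u) (\<beta>' w) (\<beta>' y)"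
        using tri2[OF parent_tri[OF p]] unfolding tri_val_eq[OF parent_cyc3[OF p]] IH .
      note q = third_cyc4[OF uw, unfolded p'(2) v_def[symmetric]]
      show ?thesis
      proof (rule positive_map_reps[OF b q], rule positive_map_reps[OF b' q], goal_cases)
        case (1 a1 n1 a2 n2 a3 n3 a4 n4 b1 m1 b2 m2 b3 m3 b4 m4)
        note r = 1(1-4)[THEN rep_act[OF g(1)], folded \<beta>2_def, unfolded IH]
        \<comment> \<open>The representatives of the two quadruples come from separate choices. On
          the common flags at \<open>u\<close> and \<open>w\<close> they differ by factors, which
          suffices to transfer nonvanishing to pairings with the other fourth flag.\<close>
        obtain c1 d1 where cd1: "c1 \<noteq> 0" "d1 \<noteq> 0" "b1 = c1 *\<^sub>R (g *v a1)" "m1 = d1 *\<^sub>R contra g n1"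
          using rep_scale_unique[OF r(1) 1(21)] by blast
        obtain c3 d3 where cd3: "c3 \<noteq> 0" "d3 \<noteq> 0" "b3 = c3 *\<^sub>R (g *v a3)" "m3 = d3 *\<^sub>R contra g n3"
          using rep_scale_unique[OF r(3) 1(23)] by blast
        have dg: "det g \<noteq> 0" using g(1) by (simp add: invertible_det_nz)
        have d: "det3 (g *v a1) (g *v a2) (g *v a3) \<noteq> 0" "det3 (g *v a1) (g *v a3) (g *v a4) \<noteq> 0"
          using dg 1(17,19) by (simp_all add: det3_matrix det3_rotate)
        have "det3 b1 b3 b4 \<noteq> 0" using 1(39) by (simp add: det3_rotate)
        then have d': "det3 (g *v a1) (g *v a3) b4 \<noteq> 0" unfolding cd1(3) cd3(3) by (simp add: det3_linear)
        have m: "contra g n1 \<bullet> b4 \<noteq> 0" "contra g n3 \<bullet> b4 \<noteq> 0"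
          "m4 \<bullet> (g *v a1) \<noteq> 0" "m4 \<bullet> (g *v a3) \<noteq> 0"
          using 1(27,33,34,36) unfolding cd1(3,4) cd3(3,4) by auto
        show ?case
          by (rule third_flag_unique[OF r 1(24) d d' _ _ _ _ _ _ _ _ m e e' t'])
            (use 1(5-16) in \<open>simp_all add: contra_inner[OF g(1)]\<close>)
      qed
    qed
  qed
  then show thesis using that[OF g(1)] by (simp add: \<beta>2_def)
qed

subsection \<open>Surjectivity\<close>

text \<open>Solutions for the lifts of the new flag of the equations prescribing its two edge coordinates
\<open>zu\<close>, \<open>zw\<close> and its triple ratio \<open>t\<close>.\<close>

definition next_point where
  "next_point zu zw u ku v w kw =
     ((kw \<bullet> v) * (1 + zw) / (kw \<bullet> u)) *\<^sub>R u - v + ((ku \<bullet> v) * (1 + 1 / zu) / (ku \<bullet> w)) *\<^sub>R (w :: real^3)"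

definition next_normal where
  "next_normal t u ku w kw x =
     (t * (ku \<bullet> x) * (kw \<bullet> u)) *\<^sub>R cross3 w x + ((ku \<bullet> w) * (kw \<bullet> x)) *\<^sub>R cross3 x u"

text \<open>Equal determinants on both sides of the edge reduce the coordinate at \<open>u\<close>
  to \<open>(ku \<bullet> v) / (ku \<bullet> x)\<close> and the one at \<open>w\<close> to
  \<open>(kw \<bullet> x) / (kw \<bullet> v)\<close>; hence the division by \<open>zu\<close> but
  multiplication by \<open>zw\<close>.\<close>

lemma next_point_props:
  fixes u v w ku kw :: "real^3" and zu zw :: real
  assumes "ku \<bullet> u = 0" "kw \<bullet> w = 0" "ku \<bullet> w > 0" "kw \<bullet> u > 0"
  shows "ku \<bullet> next_point zu zw u ku v w kw = (ku \<bullet> v) / zu"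
    "kw \<bullet> next_point zu zw u ku v w kw = zw * (kw \<bullet> v)"
    "det3 u w (next_point zu zw u ku v w kw) = det3 u v w"
proof -
  have "ku \<bullet> next_point zu zw u ku v w kw = - (ku \<bullet> v) + (ku \<bullet> v) * (1 + 1 / zu)"
    "kw \<bullet> next_point zu zw u ku v w kw = (kw \<bullet> v) * (1 + zw) - (kw \<bullet> v)"
    unfolding next_point_def using assms by (simp_all add: inner_diff_right inner_add_right)
  then show "ku \<bullet> next_point zu zw u ku v w kw = (ku \<bullet> v) / zu"
    "kw \<bullet> next_point zu zw u ku v w kw = zw * (kw \<bullet> v)"
    by (simp_all add: algebra_simps)
  show "det3 u w (next_point zu zw u ku v w kw) = det3 u v w"
    by (simp add: next_point_def det3_linear det3_swap(2)[of u w v])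
qed

text \<open>The normals of the lines \<open>wx\<close> and \<open>xu\<close> span the covectors
  vanishing at \<open>x\<close>; the coefficients are the two sides of the triple ratio equation
  after clearing denominators.\<close>

lemma next_normal_props:
  "next_normal t u ku w kw x \<bullet> x = 0"
  "next_normal t u ku w kw x \<bullet> u = t * (ku \<bullet> x) * (kw \<bullet> u) * det3 u w x"
  "next_normal t u ku w kw x \<bullet> w = (ku \<bullet> w) * (kw \<bullet> x) * det3 u w x"
  by (simp_all add: next_normal_def inner_add_left det3_cross det3_rotate)

section \<open>Recursive construction of the lifts\<close>

definition parents :: "p1q \<Rightarrow> p1q \<times> p1q" where
  "parents x = (SOME (u, w). parent x u w)"

lemma parents_eq: "parent x u w \<Longrightarrow> parents x = (u, w)"
  unfolding parents_def by (rule some_equality) (auto dest: parent_unique)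

lemma parent_parents:
  assumes "x \<noteq> Some 0" "x \<noteq> Some 1" "x \<noteq> None"
  shows "parent x (fst (parents x)) (snd (parents x))"
proof -
  have "\<not> Qf x \<le> 1" unfolding Qf_le_1_iff using assms by simp
  then obtain u w where "parent x u w" using parent_exists[of x] by auto
  then show ?thesis by (simp add: parents_eq)
qed

text \<open>The base points are the standard basis. Among the six base pairings off the diagonal all
  are 1 except one, which is therefore the triple ratio of the base triangle.\<close>

function lifts :: "(idx \<Rightarrow> real) \<Rightarrow> p1q \<Rightarrow> (real^3) \<times> (real^3)" where
  "lifts c x =
    (if x = Some 0 then (vector [1, 0, 0], vector [0, c (TriI {Some 0, Some 1, None}), 1])
     else if x = Some 1 then (vector [0, 1, 0], vector [1, 0, 1])
     else if x = None then (vector [0, 0, 1], vector [1, 1, 0])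
     else
       let u = fst (parents x); w = snd (parents x);
         Lu = lifts c u; Lw = lifts c w; Lv = lifts c (third u w);
         a = next_point (c (EdgeI u w)) (c (EdgeI w u)) (fst Lu) (snd Lu) (fst Lv) (fst Lw) (snd Lw)
       in (a, next_normal (c (TriI {u, w, x})) (fst Lu) (snd Lu) (fst Lw) (snd Lw) a))"
  by pat_completeness auto
termination
proof (relation "Wellfounded.measure (\<lambda>(c, x). nat (Qf x))", goal_cases)
  case (2 c x)
  then show ?case using parentD(3)[OF parent_parents] Qf_pos[of x] by simp
next
  case (3 c x)
  then show ?case using parentD(4)[OF parent_parents] Qf_pos[of x] by simp
next
  case (4 c x)
  then show ?case using parentD(5)[OF parent_parents] Qf_pos[of x] by simp
qed simp

declare lifts.simps [simp del]

lemma lifts_base: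
  "lifts c (Some 0) = (vector [1, 0, 0], vector [0, c (TriI {Some 0, Some 1, None}), 1])"
  "lifts c (Some 1) = (vector [0, 1, 0], vector [1, 0, 1])"
  "lifts c None = (vector [0, 0, 1], vector [1, 1, 0])"
  by (simp_all add: lifts.simps)

lemma lifts_step:
  fixes c :: "idx \<Rightarrow> real"
  assumes "parent x u w"
  defines "a \<equiv> \<lambda>y. fst (lifts c y)" and "n \<equiv> \<lambda>y. snd (lifts c y)"
  shows "a x = next_point (c (EdgeI u w)) (c (EdgeI w u)) (a u) (n u) (a (third u w)) (a w) (n w)"
    "n x = next_normal (c (TriI {u, w, x})) (a u) (n u) (a w) (n w) (a x)"
proof -
  have "Qf x > 1" using parentD(3)[OF assms(1)] Qf_pos[of u] by simp
  then have "x \<noteq> Some 0 \<and> x \<noteq> Some 1 \<and> x \<noteq> None" using Qf_le_1_iff[of x] by auto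
  then show "a x = next_point (c (EdgeI u w)) (c (EdgeI w u)) (a u) (n u) (a (third u w)) (a w) (n w)"
    "n x = next_normal (c (TriI {u, w, x})) (a u) (n u) (a w) (n w) (a x)"
    unfolding a_def n_def lifts.simps[of c x] by (simp_all add: parents_eq[OF assms(1)] Let_def del: not_None_eq)
qed

section \<open>Positivity is preserved by attaching a vertex\<close>

definition pos_config :: "p1q set \<Rightarrow> (p1q \<Rightarrow> real^3) \<Rightarrow> (p1q \<Rightarrow> real^3) \<Rightarrow> bool" where
  "pos_config S a n \<longleftrightarrow> (\<forall>x\<in>S. n x \<bullet> a x = 0) \<and> (\<forall>x\<in>S. \<forall>y\<in>S. x \<noteq> y \<longrightarrow> n x \<bullet> a y > 0) \<and>
     (\<forall>x\<in>S. \<forall>y\<in>S. \<forall>z\<in>S. cyc3 x y z \<longrightarrow> det3 (a x) (a y) (a z) > 0)"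

text \<open>Geometrically, \<open>x\<close> lies in the triangle cut off by the chord \<open>uw\<close> and the lines \<open>ku\<close>, \<open>kw\<close>,
on the side opposite to \<open>y\<close>.\<close>

lemma corner_point:
  assumes D: "det3 u y w > 0" "det3 u w x > 0"
    and k: "ku \<bullet> u = 0" "kw \<bullet> w = 0" "ku \<bullet> w > 0" "kw \<bullet> u > 0" "ku \<bullet> y > 0" "kw \<bullet> y > 0"
      "ku \<bullet> x > 0" "kw \<bullet> x > 0"
  shows "det3 u y w *\<^sub>R x = det3 y w x *\<^sub>R u - det3 u w x *\<^sub>R y + det3 u y x *\<^sub>R w"
    "det3 y w x > 0" "det3 u y x > 0"
proof -
  show eq: "det3 u y w *\<^sub>R x = det3 y w x *\<^sub>R u - det3 u w x *\<^sub>R y + det3 u y x *\<^sub>R w"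
    using cramer3[of u y w x] det3_rotate[of y w x] det3_swap(2)[of u x w] by simp
  have "det3 u y x * (ku \<bullet> w) = det3 u y w * (ku \<bullet> x) + det3 u w x * (ku \<bullet> y)"
    "det3 y w x * (kw \<bullet> u) = det3 u y w * (kw \<bullet> x) + det3 u w x * (kw \<bullet> y)"
    using arg_cong[OF eq, of "\<lambda>z. ku \<bullet> z"] arg_cong[OF eq, of "\<lambda>z. kw \<bullet> z"] k(1,2)
    by (simp_all add: inner_add_right inner_diff_right)
  moreover have "0 < det3 u y w * (ku \<bullet> x) + det3 u w x * (ku \<bullet> y)"
     "0 < det3 u y w * (kw \<bullet> x) + det3 u w x * (kw \<bullet> y)"
    by (intro add_pos_pos mult_pos_pos D k)+
  ultimately show "det3 y w x > 0" "det3 u y x > 0"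
    using k(3,4) zero_less_mult_pos2 by metis+
qed

text \<open>Only inequalities involving \<open>u\<close>, \<open>w\<close> and \<open>x\<close> are
  assumed for the new vertex; the relation of \<open>corner_point\<close> spreads them to all of
  \<open>S\<close>.\<close>

lemma pos_config_insert:
  assumes S: "pos_config S a n" and uw: "u \<in> S" "w \<in> S" "cyc3 w x u" and x: "x \<notin> S"
    and arc: "\<And>y. y \<in> S \<Longrightarrow> y \<noteq> u \<Longrightarrow> y \<noteq> w \<Longrightarrow> cyc3 u y w"
    and ax: "n u \<bullet> a x > 0" "n w \<bullet> a x > 0" "det3 (a u) (a w) (a x) > 0"
    and nx: "n x \<bullet> a x = 0" "n x \<bullet> a u > 0" "n x \<bullet> a w > 0"
  shows "pos_config (insert x S) a n"
proof -
  have uw_neq: "u \<noteq> w" using cyc3_neq[OF uw(3)] by blast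
  have n0: "n y \<bullet> a y = 0" if "y \<in> S" for y using S that by (simp add: pos_config_def)
  have npos: "n y \<bullet> a z > 0" if "y \<in> S" "z \<in> S" "y \<noteq> z" for y z using S that by (simp add: pos_config_def)
  have dpos: "det3 (a y) (a z) (a t) > 0" if "y \<in> S" "z \<in> S" "t \<in> S" "cyc3 y z t" for y z t
    using S that by (simp add: pos_config_def)
  have inner: "det3 (a u) (a y) (a w) *\<^sub>R a x = det3 (a y) (a w) (a x) *\<^sub>R a u
       - det3 (a u) (a w) (a x) *\<^sub>R a y + det3 (a u) (a y) (a x) *\<^sub>R a w"
    "det3 (a y) (a w) (a x) > 0" "det3 (a u) (a y) (a x) > 0" "det3 (a u) (a y) (a w) > 0"
    if y: "y \<in> S" "y \<noteq> u" "y \<noteq> w" for y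
  proof -
    show d: "det3 (a u) (a y) (a w) > 0" using dpos uw(1,2) y(1) arc[OF y] by blast
    note c = corner_point[OF d ax(3) n0[OF uw(1)] n0[OF uw(2)] npos[OF uw(1,2) uw_neq]
        npos[OF uw(2,1) uw_neq[symmetric]] npos[OF uw(1) y(1) y(2)[symmetric]]
        npos[OF uw(2) y(1) y(3)[symmetric]] ax(1,2)]
    show "det3 (a u) (a y) (a w) *\<^sub>R a x = det3 (a y) (a w) (a x) *\<^sub>R a u
       - det3 (a u) (a w) (a x) *\<^sub>R a y + det3 (a u) (a y) (a x) *\<^sub>R a w"
      "det3 (a y) (a w) (a x) > 0" "det3 (a u) (a y) (a x) > 0"
      by (rule c)+
  qed
  \<comment> \<open>Pairing the relation with \<open>n y\<close> removes its only negative term.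
    Pairing it with \<open>n x\<close> removes the left side, and the negative term moved across
    contains the value sought.\<close>
  have old_new: "n y \<bullet> a x > 0" and new_old: "n x \<bullet> a y > 0" if "y \<in> S" for y
  proof -
    consider "y = u" | "y = w" | "y \<noteq> u" "y \<noteq> w" by blast
    then have "n y \<bullet> a x > 0 \<and> n x \<bullet> a y > 0"
    proof cases
      case 3
      note i = inner[OF that 3]
      have "det3 (a u) (a y) (a w) * (n y \<bullet> a x)
          = det3 (a y) (a w) (a x) * (n y \<bullet> a u) + det3 (a u) (a y) (a x) * (n y \<bullet> a w)"
        using arg_cong[OF i(1), of "\<lambda>z. n y \<bullet> z"] n0[OF that]
        by (simp add: inner_add_right inner_diff_right)
      moreover have "0 < det3 (a y) (a w) (a x) * (n y \<bullet> a u) + det3 (a u) (a y) (a x) * (n y \<bullet> a w)"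
        by (intro add_pos_pos mult_pos_pos i npos that uw 3)
      ultimately have "n y \<bullet> a x > 0" using i(4) zero_less_mult_pos by metis
      have "det3 (a u) (a w) (a x) * (n x \<bullet> a y)
          = det3 (a y) (a w) (a x) * (n x \<bullet> a u) + det3 (a u) (a y) (a x) * (n x \<bullet> a w)"
        using arg_cong[OF i(1), of "\<lambda>z. n x \<bullet> z"] nx(1)
        by (simp add: inner_add_right inner_diff_right)
      moreover have "0 < det3 (a y) (a w) (a x) * (n x \<bullet> a u) + det3 (a u) (a y) (a x) * (n x \<bullet> a w)"
        by (intro add_pos_pos mult_pos_pos i nx)
      ultimately have "n x \<bullet> a y > 0" using ax(3) zero_less_mult_pos by metis
      with \<open>n y \<bullet> a x > 0\<close> show ?thesis ..
    qed (use ax nx in simp_all)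
    then show "n y \<bullet> a x > 0" "n x \<bullet> a y > 0" by blast+
  qed
  have det: "det3 (a y) (a z) (a x) > 0" if yz: "y \<in> S" "z \<in> S" "cyc3 y z x" for y z
  proof -
    have in_arc: "t = u \<or> t = w \<or> cyc3 u t w" if "t \<in> S" for t using arc that by blast
    have ne: "y \<noteq> w" "z \<noteq> u"
      using cyc3_chord[OF uw(3) yz(3)] in_arc yz(1,2) by blast+
    note yz_ne = cyc3_neq[OF yz(3)]
    consider "y = u" "z = w" | "y = u" "z \<noteq> w" | "y \<noteq> u" "z = w" | "y \<noteq> u" "z \<noteq> w" by blast
    then show ?thesis
    proof cases
      case 1 then show ?thesis using ax(3) by simp
    next
      case 2 then show ?thesis using inner(3)[OF yz(2) ne(2)] by simp
    next
      case 3 then show ?thesis using inner(2)[OF yz(1) _ ne(1)] by simp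
    next
      case 4
      note i = inner[OF yz(1) 4(1) ne(1)]
      note cyc = cyc3_nested[OF arc[OF yz(1) 4(1) ne(1)] arc[OF yz(2) ne(2) 4(2)] uw(3) yz(3)]
      \<comment> \<open>Here \<open>y\<close> and \<open>z\<close> are interior to the arc.
        Expanding \<open>a x\<close> by the relation for \<open>y\<close>, the term in
        \<open>a y\<close> drops out and two old triples in cyclic order remain.\<close>
      have "det3 (a u) (a y) (a w) * det3 (a y) (a z) (a x) = det3 (a y) (a z) (det3 (a u) (a y) (a w) *\<^sub>R a x)"
        by (simp add: det3_linear)
      also have "\<dots> = det3 (a y) (a w) (a x) * det3 (a y) (a z) (a u) + det3 (a u) (a y) (a x) * det3 (a y) (a z) (a w)"
        unfolding i(1) by (simp add: det3_linear)
      also have "\<dots> > 0"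
        by (intro add_pos_pos mult_pos_pos i dpos yz uw cyc)
      finally show ?thesis using i(4) zero_less_mult_pos by metis
    qed
  qed
  show ?thesis
    unfolding pos_config_def
  proof (intro conjI ballI impI)
    fix y assume "y \<in> insert x S" then show "n y \<bullet> a y = 0" using n0 nx by auto
  next
    fix y z assume "y \<in> insert x S" "z \<in> insert x S" "y \<noteq> z"
    then show "n y \<bullet> a z > 0" using npos old_new new_old by auto
  next
    fix p q r assume pqr: "p \<in> insert x S" "q \<in> insert x S" "r \<in> insert x S" "cyc3 p q r"
    note ne = cyc3_neq[OF pqr(4)]
    consider "p \<in> S" "q \<in> S" "r \<in> S" | "r = x" "p \<in> S" "q \<in> S" | "q = x" "p \<in> S" "r \<in> S"
      | "p = x" "q \<in> S" "r \<in> S" using pqr ne by blast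
    then show "det3 (a p) (a q) (a r) > 0"
    proof cases
      case 1 then show ?thesis using dpos pqr(4) by blast
    next
      case 2 then show ?thesis using det pqr(4) by blast
    next
      case 3
      then have "det3 (a r) (a p) (a x) > 0" using det pqr(4) cyc3_rotate by blast
      then show ?thesis using 3 det3_rotate[of "a p" "a x" "a r"] by simp
    next
      case 4
      then have "det3 (a q) (a r) (a x) > 0" using det pqr(4) cyc3_rotate by blast
      then show ?thesis using 4 det3_rotate[of "a q" "a r" "a x"] by simp
    qed
  qed
qed
text \<open>Applied to finite sets these relations extend positivity; applied to \<open>UNIV\<close>
  they give the coordinates of the finished map.\<close>

lemma lifts_relations:
  fixes c :: "idx \<Rightarrow> real"
  assumes p: "parent x u w" and S: "pos_config S a n" "u \<in> S" "w \<in> S" "third u w \<in> S"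
    and c: "c (EdgeI u w) > 0" "c (EdgeI w u) > 0" "c (TriI {u, w, x}) > 0"
    and a: "a = (\<lambda>y. fst (lifts c y))" and n: "n = (\<lambda>y. snd (lifts c y))"
  shows "n u \<bullet> a x = (n u \<bullet> a (third u w)) / c (EdgeI u w)"
    "n w \<bullet> a x = c (EdgeI w u) * (n w \<bullet> a (third u w))"
    "det3 (a u) (a w) (a x) = det3 (a u) (a (third u w)) (a w)"
    "n x \<bullet> a x = 0"
    "n x \<bullet> a u = c (TriI {u, w, x}) * (n u \<bullet> a x) * (n w \<bullet> a u) * det3 (a u) (a w) (a x)"
    "n x \<bullet> a w = (n u \<bullet> a w) * (n w \<bullet> a x) * det3 (a u) (a w) (a x)"
    "n u \<bullet> a x > 0" "n w \<bullet> a x > 0" "det3 (a u) (a w) (a x) > 0" "n x \<bullet> a u > 0" "n x \<bullet> a w > 0"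
proof -
  define v where "v = third u w"
  note uw = parentD(1)[OF p]
  have ne: "u \<noteq> w" "v \<noteq> u" "v \<noteq> w" and cyc: "cyc3 u v w"
    using farey_adj_neq[OF uw] third_props(3)[OF uw] cyc3_neq[of u v w] by (auto simp: v_def)
  have k: "n u \<bullet> a u = 0" "n w \<bullet> a w = 0" "n u \<bullet> a w > 0" "n w \<bullet> a u > 0" "n u \<bullet> a v > 0" "n w \<bullet> a v > 0"
    and d: "det3 (a u) (a v) (a w) > 0"
    using S ne cyc unfolding v_def[symmetric] pos_config_def by auto
  have ax: "a x = next_point (c (EdgeI u w)) (c (EdgeI w u)) (a u) (n u) (a v) (a w) (n w)"
    and nx: "n x = next_normal (c (TriI {u, w, x})) (a u) (n u) (a w) (n w) (a x)"
    unfolding a n v_def by (rule lifts_step[OF p])+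
  note P = next_point_props[OF k(1-4), of "c (EdgeI u w)" "c (EdgeI w u)" "a v", folded ax]
  note N = next_normal_props[of "c (TriI {u, w, x})" "a u" "n u" "a w" "n w" "a x", folded nx]
  show "n u \<bullet> a x = (n u \<bullet> a (third u w)) / c (EdgeI u w)"
    "n w \<bullet> a x = c (EdgeI w u) * (n w \<bullet> a (third u w))"
    "det3 (a u) (a w) (a x) = det3 (a u) (a (third u w)) (a w)"
    unfolding v_def[symmetric] by (rule P)+
  show "n x \<bullet> a x = 0"
    "n x \<bullet> a u = c (TriI {u, w, x}) * (n u \<bullet> a x) * (n w \<bullet> a u) * det3 (a u) (a w) (a x)"
    "n x \<bullet> a w = (n u \<bullet> a w) * (n w \<bullet> a x) * det3 (a u) (a w) (a x)"
    by (rule N)+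
  show pos: "n u \<bullet> a x > 0" "n w \<bullet> a x > 0" "det3 (a u) (a w) (a x) > 0"
    unfolding P using k(5,6) c(1,2) d by simp_all
  show "n x \<bullet> a u > 0" "n x \<bullet> a w > 0"
    unfolding N by (intro mult_pos_pos c pos k)+
qed

text \<open>On a finite set closed under parent edges and their opposite vertices, the vertex of
  largest \<open>Qf\<close> can be removed and reattached: what it depends on has smaller value, and
  all others lie across its parent edge by \<open>parent_arc\<close>.\<close>

lemma lifts_positive:
  assumes c: "c \<in> I3 \<rightarrow>\<^sub>E {0<..}"
    and a: "a = (\<lambda>y. fst (lifts c y))" and n: "n = (\<lambda>y. snd (lifts c y))"
  shows "pos_config UNIV a n"
proof -
  have cT: "c (TriI T) > 0" if "farey_tri T" for T using c that by (auto simp: I3_def PiE_iff)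
  have cE: "c (EdgeI u w) > 0" if "farey_adj u w" for u w using c that by (auto simp: I3_def PiE_iff)
  have "pos_config {Some 0, Some 1, None} a n"
  proof -
    have an: "a (Some 0) = vector [1, 0, 0]" "a (Some 1) = vector [0, 1, 0]" "a None = vector [0, 0, 1]"
      "n (Some 0) = vector [0, c (TriI {Some 0, Some 1, None}), 1]"
      "n (Some 1) = vector [1, 0, 1]" "n None = vector [1, 1, 0]"
      by (simp_all add: a n lifts_base)
    have "\<not> cyc3 (Some 1) (Some 0) None" "\<not> cyc3 (Some 0) None (Some 1)" "\<not> cyc3 None (Some 1) (Some 0)"
      by (simp_all add: cyc3_def ext_less_def)
    moreover have "\<not> cyc3 x x y" "\<not> cyc3 x y x" "\<not> cyc3 y x x" for x y using cyc3_neq by blast+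
    ultimately show ?thesis using cT[OF base_tri]
      by (auto simp: pos_config_def an inner3 det3_expand vector_3)
  qed
  note base = this
  have closed: "pos_config S a n"
    if "finite S" "{Some 0, Some 1, None} \<subseteq> S"
      "\<And>x u w. x \<in> S \<Longrightarrow> parent x u w \<Longrightarrow> u \<in> S \<and> w \<in> S \<and> third u w \<in> S" for S
    using that
  proof (induction S rule: finite_psubset_induct)
    case (psubset S)
    show ?case
    proof (cases "S = {Some 0, Some 1, None}")
      case True
      then show ?thesis using base by simp
    next
      case False
      obtain x where x: "x \<in> S" "\<And>y. y \<in> S \<Longrightarrow> Qf y \<le> Qf x"
        using psubset.hyps psubset.prems(1) finite_has_maximal[of "Qf ` S"]
        by (metis (no_types, lifting) Max_ge Max_in finite_imageI image_iff image_is_empty insert_not_empty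
            subset_empty image_eqI)
      have "Qf x > 1"
      proof (rule ccontr)
        assume "\<not> Qf x > 1"
        then have "S \<subseteq> {Some 0, Some 1, None}"
          using x(2) by (meson Qf_le_1_iff not_less order_trans subsetI)
        then show False using False psubset.prems(1) by simp
      qed
      then obtain u w where p: "parent x u w" using parent_exists by blast
      define S' where "S' = S - {x}"
      have S: "S = insert x S'" and xS': "x \<notin> S'" using x(1) by (auto simp: S'_def)
      have "{Some 0, Some 1, None} \<subseteq> S'"
        using psubset.prems(1) \<open>Qf x > 1\<close> Qf_le_1_iff[of x] by (auto simp: S'_def)
      moreover have "u' \<in> S' \<and> w' \<in> S' \<and> third u' w' \<in> S'" if "y \<in> S'" "parent y u' w'" for y u' w'
        using psubset.prems(2)[of y u' w'] parentD(3-5)[OF that(2)] x(2)[of y] that by (auto simp: S'_def)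
      moreover have "S' \<subset> S" using S xS' by blast
      ultimately have S': "pos_config S' a n" using psubset.IH by blast
      have uS: "u \<in> S'" "w \<in> S'" "third u w \<in> S'"
        using psubset.prems(2)[OF x(1) p] parentD(3-5)[OF p] by (auto simp: S'_def)
      have uw: "farey_adj u w" "farey_adj w u" using parentD(1)[OF p] by (simp_all add: farey_adj_sym)
      note L = lifts_relations[OF p S' uS cE[OF uw(1)] cE[OF uw(2)] cT[OF parent_tri[OF p]] a n]
      show ?thesis unfolding S
      proof (rule pos_config_insert[OF S' uS(1,2) parentD(8)[OF p] xS' _ L(7-9) L(4) L(10,11)])
        fix y assume "y \<in> S'" "y \<noteq> u" "y \<noteq> w"
        then show "cyc3 u y w" using parent_arc[OF p, of y] x(2)[of y] by (auto simp: S'_def)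
      qed
    qed
  qed
  have fin: "pos_config {x. Qf x \<le> m} a n" if "m \<ge> 1" for m
  proof -
    have "Some 0 \<in> {x. Qf x \<le> m}" "Some 1 \<in> {x. Qf x \<le> m}" "None \<in> {x. Qf x \<le> m}"
      using Qf_le_1_iff[of "Some 0"] Qf_le_1_iff[of "Some 1"] Qf_le_1_iff[of None] that by auto
    then show ?thesis
    proof (intro closed finite_Qf_le)
      fix x u w assume "x \<in> {x. Qf x \<le> m}" "parent x u w"
      then show "u \<in> {x. Qf x \<le> m} \<and> w \<in> {x. Qf x \<le> m} \<and> third u w \<in> {x. Qf x \<le> m}"
        using parentD(3-5)[of x u w] by simp
    qed blast
  qed
  show ?thesis
    unfolding pos_config_def
  proof (intro conjI ballI impI)
    fix x y z
    \<comment> \<open>Each condition concerns at most three vertices, so a finite sublevel set of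
      \<open>Qf\<close> containing them suffices.\<close>
    define m where "m = Max {Qf x, Qf y, Qf z}"
    have "Qf x \<le> m" "Qf y \<le> m" "Qf z \<le> m" by (simp_all add: m_def)
    moreover from this have "m \<ge> 1" using Qf_pos[of x] by linarith
    ultimately have *: "pos_config {x. Qf x \<le> m} a n" "x \<in> {x. Qf x \<le> m}" "y \<in> {x. Qf x \<le> m}" "z \<in> {x. Qf x \<le> m}"
      using fin by simp_all
    show "n x \<bullet> a x = 0" using * unfolding pos_config_def by blast
    show "n x \<bullet> a y > 0" if "x \<noteq> y" using * that unfolding pos_config_def by blast
    show "det3 (a x) (a y) (a z) > 0" if "cyc3 x y z" using * that unfolding pos_config_def by blast
  qed
qed

lemma coordinates_surjective:
  assumes c: "c \<in> I3 \<rightarrow>\<^sub>E {0<..}"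
  obtains \<beta> where "positive_map \<beta>" "phi_map \<beta> = c"
proof -
  define a where "a = (\<lambda>y. fst (lifts c y))"
  define n where "n = (\<lambda>y. snd (lifts c y))"
  define \<beta> where "\<beta> y = (span {a y}, {z. n y \<bullet> z = 0})" for y
  have P: "pos_config UNIV a n" by (rule lifts_positive[OF c a_def n_def])
  have n0: "n y \<bullet> a y = 0" and npos: "y \<noteq> z \<Longrightarrow> n y \<bullet> a z > 0"
    and dpos: "cyc3 y z t \<Longrightarrow> det3 (a y) (a z) (a t) > 0" for y z t
    using P by (simp_all add: pos_config_def)
  have r: "rep (\<beta> y) (a y) (n y)" for y
  proof -
    obtain z where "z \<noteq> y" by (metis option.distinct(1))
    then have "n y \<bullet> a z > 0" "n z \<bullet> a y > 0" using npos by auto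
    then have "a y \<noteq> 0" "n y \<noteq> 0" by auto
    then show ?thesis by (simp add: rep_def \<beta>_def n0)
  qed
  have pos: "positive_map \<beta>"
    unfolding positive_map_def
  proof (intro conjI allI impI)
    show "is_flag (\<beta> y)" for y using r is_flag_iff_rep by blast
    fix x1 x2 x3 x4 assume "cyc4 x1 x2 x3 x4"
    note cyc = cyc4_imp_cyc3[OF this]
    have ne: "x1 \<noteq> x2" "x1 \<noteq> x3" "x1 \<noteq> x4" "x2 \<noteq> x1" "x2 \<noteq> x3" "x2 \<noteq> x4"
      "x3 \<noteq> x1" "x3 \<noteq> x2" "x3 \<noteq> x4" "x4 \<noteq> x1" "x4 \<noteq> x2" "x4 \<noteq> x3"
      using cyc[THEN cyc3_neq] by auto
    show "positive_quad (\<beta> x1) (\<beta> x2) (\<beta> x3) (\<beta> x4)"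
      by (rule positive_quadI[OF r r r r]; rule npos dpos; rule ne cyc)
  qed
  have cT: "c (TriI T) > 0" if "farey_tri T" for T using c that by (auto simp: I3_def PiE_iff)
  have cE: "c (EdgeI u w) > 0" if "farey_adj u w" for u w using c that by (auto simp: I3_def PiE_iff)
  \<comment> \<open>By \<open>farey_tri_cases\<close> and \<open>edge_parent\<close>, checking
    coordinates at each attachment covers all indices except the base triangle.\<close>
  have vals: "tri_val \<beta> {u, w, x} = c (TriI {u, w, x})" "edge_val \<beta> u w = c (EdgeI u w)"
      "edge_val \<beta> w u = c (EdgeI w u)" if p: "parent x u w" for x u w
  proof -
    define v where "v = third u w"
    have uw: "farey_adj u w" "farey_adj w u" using parentD(1)[OF p] by (simp_all add: farey_adj_sym)
    have ne: "u \<noteq> w" "w \<noteq> u" "u \<noteq> v" "w \<noteq> v" "v \<noteq> w"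
      using farey_adj_neq[OF uw(1)] third_props(3)[OF uw(1)] cyc3_neq[of u v w] by (auto simp: v_def)
    note L = lifts_relations[OF p P UNIV_I UNIV_I UNIV_I cE[OF uw(1)] cE[OF uw(2)] cT[OF parent_tri[OF p]]
        a_def n_def, folded v_def]
    have k: "n u \<bullet> a w \<noteq> 0" "n w \<bullet> a u \<noteq> 0" "n u \<bullet> a v \<noteq> 0" "n w \<bullet> a v \<noteq> 0"
      using npos ne by (metis less_irrefl)+
    have D: "det3 (a u) (a v) (a w) \<noteq> 0" "det3 (a u) (a w) (a x) \<noteq> 0" using L(3,9) by simp_all
    have D': "det3 (a w) (a u) (a v) = det3 (a u) (a v) (a w)" "det3 (a w) (a x) (a u) = det3 (a u) (a w) (a x)"
      by (simp_all add: det3_rotate)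
    then have D'': "det3 (a w) (a x) (a u) \<noteq> 0" "det3 (a w) (a u) (a v) \<noteq> 0" using D by simp_all
    have cnz: "c (EdgeI u w) \<noteq> 0" "c (EdgeI w u) \<noteq> 0" using cE uw by (metis less_irrefl)+
    show "tri_val \<beta> {u, w, x} = c (TriI {u, w, x})"
      unfolding tri_val_eq[OF parent_cyc3[OF p]] triple_ratio_rep[OF r r r] L(5,6)
      using k D L(7,8) by simp
    show "edge_val \<beta> u w = c (EdgeI u w)"
      unfolding edge_val_eq[OF uw(1)] parentD(2)[OF p] v_def[symmetric] edge_ratio_rep[OF r r r r D] L(1) L(3)
      using k D cnz by simp
    show "edge_val \<beta> w u = c (EdgeI w u)"
      unfolding edge_val_eq[OF uw(2)] parentD(2)[OF p] v_def[symmetric] edge_ratio_rep[OF r r r r D''] L(2) D' L(3)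
      using k D by simp
  qed
  have "phi_map \<beta> = c"
  proof (rule phi_map_eqI)
    fix T assume "farey_tri T"
    then show "tri_val \<beta> T = c (TriI T)"
    proof (cases rule: farey_tri_cases)
      case base
      have "a (Some 0) = vector [1, 0, 0]" "a (Some 1) = vector [0, 1, 0]" "a None = vector [0, 0, 1]"
        "n (Some 0) = vector [0, c (TriI {Some 0, Some 1, None}), 1]"
        "n (Some 1) = vector [1, 0, 1]" "n None = vector [1, 1, 0]"
        by (simp_all add: a_def n_def lifts_base)
      then show ?thesis
        unfolding base tri_val_eq[OF base_cyc3] triple_ratio_rep[OF r r r] by (simp add: inner3 vector_3)
    next
      case (parent x u w)
      then show ?thesis using vals(1) by simp
    qed
  next
    fix u w assume "farey_adj u w"
    then show "edge_val \<beta> u w = c (EdgeI u w)" using edge_parent[of u w] vals(2,3) by blast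
  next
    show "c \<in> extensional I3" using c by (simp add: PiE_def)
  qed
  then show thesis using that pos by blast
qed

subsection \<open>The quotient\<close>

lemma act_mult: "act (g ** h) F = act g (act h F)"
  by (simp add: act_def image_image matrix_vector_mul_assoc)

lemma act_one: "act (mat 1) F = F"
  by (simp add: act_def)

lemma equiv_pgl_rel: "equiv {\<beta>. positive_map \<beta>} pgl_rel"
proof (rule equivI)
  show "pgl_rel \<subseteq> {\<beta>. positive_map \<beta>} \<times> {\<beta>. positive_map \<beta>}" by (auto simp: pgl_rel_def)
  have "invertible (mat 1 :: real^3^3)" unfolding invertible_def by (intro exI[of _ "mat 1"]) simp
  then show "refl_on {\<beta>. positive_map \<beta>} pgl_rel"
    by (intro refl_onI) (auto simp: pgl_rel_def act_one intro!: exI[of _ "mat 1"])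
  show "sym pgl_rel"
  proof (rule symI)
    fix \<beta> \<beta>' assume "(\<beta>, \<beta>') \<in> pgl_rel"
    then obtain g where g: "positive_map \<beta>" "positive_map \<beta>'" "invertible g" "\<And>y. \<beta>' y = act g (\<beta> y)"
      by (auto simp: pgl_rel_def)
    have "\<beta> y = act (matrix_inv g) (\<beta>' y)" for y
      by (simp add: g(4) act_mult[symmetric] matrix_inv_mult[OF g(3)] act_one)
    moreover have "invertible (matrix_inv g)"
      using matrix_inv_mult[OF g(3)] unfolding invertible_def by blast
    ultimately show "(\<beta>', \<beta>) \<in> pgl_rel" using g by (auto simp: pgl_rel_def)
  qed
  show "trans pgl_rel"
  proof (rule transI)
    fix \<beta>1 \<beta>2 \<beta>3 assume "(\<beta>1, \<beta>2) \<in> pgl_rel" "(\<beta>2, \<beta>3) \<in> pgl_rel"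
    then obtain g h where g: "positive_map \<beta>1" "positive_map \<beta>3" "invertible g" "invertible h"
      "\<And>y. \<beta>2 y = act g (\<beta>1 y)" "\<And>y. \<beta>3 y = act h (\<beta>2 y)"
      by (auto simp: pgl_rel_def)
    then have "\<beta>3 y = act (h ** g) (\<beta>1 y)" for y by (simp add: act_mult)
    then show "(\<beta>1, \<beta>3) \<in> pgl_rel"
      using g invertible_mult[OF g(4,3)] by (auto simp: pgl_rel_def)
  qed
qed

text \<open>\<open>phi3\<close> evaluates an arbitrary member of the class, and invariance makes
  this choice irrelevant.\<close>

lemma phi3_class:
  assumes "positive_map \<beta>"
  shows "phi3 (pgl_rel `` {\<beta>}) = phi_map \<beta>"
proof -
  define \<beta>' where "\<beta>' = (SOME \<beta>'. \<beta>' \<in> pgl_rel `` {\<beta>})"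
  have "\<beta>' \<in> pgl_rel `` {\<beta>}"
    unfolding \<beta>'_def
    by (rule someI[of _ \<beta>], rule equiv_class_self[OF equiv_pgl_rel]) (use assms in simp)
  then obtain g where "invertible g" "\<And>y. \<beta>' y = act g (\<beta> y)" by (auto simp: pgl_rel_def)
  then show ?thesis unfolding phi3_def \<beta>'_def[symmetric] by (rule phi_map_act[OF assms])
qed

theorem mainTheorem9:
  shows "bij_betw phi3 T3 (I3 \<rightarrow>\<^sub>E {0<..})"
  unfolding bij_betw_def
proof (intro conjI inj_onI)
  fix C D assume "C \<in> T3" "D \<in> T3" and eq: "phi3 C = phi3 D"
  then obtain \<beta> \<beta>' where b: "positive_map \<beta>" "positive_map \<beta>'" and
    C: "C = pgl_rel `` {\<beta>}" and D: "D = pgl_rel `` {\<beta>'}"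
    by (auto simp: T3_def quotient_def)
  have "phi_map \<beta> = phi_map \<beta>'" using eq b by (simp add: C D phi3_class)
  then obtain g where "invertible g" "\<And>y. \<beta>' y = act g (\<beta> y)"
    using equal_coordinates_equivalent[OF b] by blast
  then have "(\<beta>, \<beta>') \<in> pgl_rel" using b by (auto simp: pgl_rel_def)
  then show "C = D" unfolding C D by (rule equiv_class_eq[OF equiv_pgl_rel])
next
  show "phi3 ` T3 = I3 \<rightarrow>\<^sub>E {0<..}"
  proof (intro set_eqI iffI)
    fix c assume "c \<in> phi3 ` T3"
    then obtain \<beta> where "positive_map \<beta>" "c = phi3 (pgl_rel `` {\<beta>})"
      by (auto simp: T3_def quotient_def)
    then show "c \<in> I3 \<rightarrow>\<^sub>E {0<..}" by (simp only: phi3_class phi_map_in)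
  next
    fix c :: "idx \<Rightarrow> real" assume "c \<in> I3 \<rightarrow>\<^sub>E {0<..}"
    then obtain \<beta> where b: "positive_map \<beta>" "phi_map \<beta> = c" using coordinates_surjective by blast
    then have "pgl_rel `` {\<beta>} \<in> T3" by (auto simp: T3_def quotient_def)
    then show "c \<in> phi3 ` T3" using phi3_class[OF b(1)] b(2) by (metis image_eqI)
  qed
qed

end
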